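(* Let $P:\mathbb{C}^{\mathrm{op}}\to\mathbf{Pos}$ be a bounded consistent implicational existential rich doctrine, let $\nabla\subseteq P(\mathbf{t})$ be an ultrafilter, and let $P/\nabla:\mathbb{C}^{\mathrm{op}}\to\mathbf{Pos}$ be the quotient doctrine. Then the pair $(\Gamma,\mathfrak{g}):P/\nabla\to\mathscr{P}_*$, where $\Gamma=\mathrm{Hom}_{\mathbb{C}}(\mathbf{t},-):\mathbb{C}\to\mathrm{Set}_*$ and $$\mathfrak{g}_X[\varphi]=\{c:\mathbf{t}\to X\mid P(c)\varphi\in\nabla\}$$ for any object $X$ and any $[\varphi]\in P/\nabla(X)$, is a bounded existential implicational morphism of doctrines.
   Context: **Doctrines.** $\mathbf{Pos}$ is the category of posets and monotone maps. A doctrine is a functor $P:\mathbb{C}^{\mathrm{op}}\to\mathbf{Pos}$ where $\mathbb{C}$ has finite products; $\mathbf{t}$ is the terminal object, $!_X:X\to\mathbf{t}$ the unique arrow. $P$ is primary if every $P(A)$ has finite meets (including $\top$), preserved by reindexings $P(f)$. $P$ is implicational if every $P(A)$ has finite meets and a Heyting implication $\to$, all preserved by reindexings. $P$ is bounded if every $P(A)$ has top and bottom elements preserved by reindexings. A primary doctrine $P$ is existential if for all objects $B,C$ the map $P(\mathrm{pr}_1):P(C)\to P(C\times B)$ has a left adjoint $\exists^B_C$ satisfying Beck–Chevalley ($\exists^B_C P(f\times \mathrm{id}_B)=P(f)\exists^B_{C'}$ for all $f:C\to C'$) and Frobenius reciprocity ($\exists^B_C(\alpha\wedge P(\mathrm{pr}_1)\beta)=\exists^B_C(\alpha)\wedge\beta$).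 $P$ is consistent if there are $a,b\in P(\mathbf{t})$ with $a\nleq b$. An existential doctrine $P$ is rich if for every object $A$ and $\sigma\in P(A)$ there is an arrow $d:\mathbf{t}\to A$ with $\exists^A_{\mathbf{t}}\sigma\le P(d)\sigma$. **Morphisms.** A doctrine morphism $(F,\mathfrak{f})$ from $P:\mathbb{C}^{\mathrm{op}}\to\mathbf{Pos}$ to $R:\mathbb{D}^{\mathrm{op}}\to\mathbf{Pos}$ consists of a functor $F:\mathbb{C}\to\mathbb{D}$ preserving finite products and a natural transformation $\mathfrak{f}:P\to R\circ F^{\mathrm{op}}$. It is bounded/implicational/existential if both $P$ and $R$ are and $\mathfrak{f}$ preserves the corresponding structure (top and bottom; finite meets and implication; finite meets and existential quantifiers). **Subsets doctrine.** $\mathrm{Set}_*$ is the category of non-empty sets and functions, and $\mathscr{P}_*:\mathrm{Set}_*^{\mathrm{op}}\to\mathbf{Pos}$ sends a set to its powerset ordered by inclusion and a function to its inverse-image map. (Its existential quantifier is direct image along projections.) **Filters and quotient.** A filter in an inf-semilattice is an upward closed subset containing $\top$ and closed under binary meets. In a bounded implicative inf-semilattice $L$ (finite meets, implication, bottom), a filter $\nabla$ is an ultrafilter if for every $a\in L$ exactly one of $a\in\nabla$, $\lnot a\in\nabla$ holds, where $\lnot a=a\to\bot$. For a primary doctrine $P$ and a filter $\nabla\subseteq P(\mathbf{t})$, define on each $P(X)$ the preorder $\alpha\sqsubseteq_\nabla\beta$ iff there is $\theta\in\nabla$ with $P(!_X)\theta\wedge\alpha\le\beta$; $P/\nabla(X)$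 is the poset reflection of this preorder, with classes $[\alpha]$, and $P/\nabla(f)[\alpha]=[P(f)\alpha]$. When $P$ is bounded existential implicational, so is $P/\nabla$, with operations computed on representatives. *)

theory Defs
  imports
    "HOL-Algebra.Galois_Connection"
    "HOL-Library.FuncSet"
    "HOL-Library.Infinite_Typeclass"
begin

section \<open>Categories with finite products\<close>

record ('o, 'm) cat =
  Obj :: "'o set"
  Arr :: "'m set"
  Src :: "'m \<Rightarrow> 'o"
  Tgt :: "'m \<Rightarrow> 'o"
  Idt :: "'o \<Rightarrow> 'm"
  Cmp :: "'m \<Rightarrow> 'm \<Rightarrow> 'm"  (infixr \<open>\<odot>\<index>\<close> 75)

definition homset :: "('o, 'm) cat \<Rightarrow> 'o \<Rightarrow> 'o \<Rightarrow> 'm set" where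
  "homset C X Y = {f \<in> Arr C. Src C f = X \<and> Tgt C f = Y}"

locale category =
  fixes C :: "('o, 'm) cat" (structure)
  assumes Src_Obj: "f \<in> Arr C \<Longrightarrow> Src C f \<in> Obj C"
    and Tgt_Obj: "f \<in> Arr C \<Longrightarrow> Tgt C f \<in> Obj C"
    and Idt_homset: "X \<in> Obj C \<Longrightarrow> Idt C X \<in> homset C X X"
    and Cmp_homset: "\<lbrakk>f \<in> homset C X Y; g \<in> homset C Y Z\<rbrakk> \<Longrightarrow> g \<odot> f \<in> homset C X Z"
    and Cmp_Idt_left: "f \<in> homset C X Y \<Longrightarrow> Idt C Y \<odot> f = f"
    and Cmp_Idt_right: "f \<in> homset C X Y \<Longrightarrow> f \<odot> Idt C X = f"
    and Cmp_assoc: "\<lbrakk>f \<in> homset C W X; g \<in> homset C X Y; h \<in> homset C Y Z\<rbrakk>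
        \<Longrightarrow> (h \<odot> g) \<odot> f = h \<odot> (g \<odot> f)"

definition terminal_object :: "('o, 'm) cat \<Rightarrow> 'o \<Rightarrow> bool" where
  "terminal_object C t \<longleftrightarrow> t \<in> Obj C \<and> (\<forall>X\<in>Obj C. \<exists>!f. f \<in> homset C X t)"

definition bang :: "('o, 'm) cat \<Rightarrow> 'o \<Rightarrow> 'o \<Rightarrow> 'm" where
  "bang C t X = (THE f. f \<in> homset C X t)"

definition product_cone :: "('o, 'm) cat \<Rightarrow> 'o \<Rightarrow> 'o \<Rightarrow> 'o \<Rightarrow> 'm \<Rightarrow> 'm \<Rightarrow> bool" where
  "product_cone C X Y W p q \<longleftrightarrow>
     X \<in> Obj C \<and> Y \<in> Obj C \<and> W \<in> Obj C \<and> p \<in> homset C W X \<and> q \<in> homset C W Y \<and>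
     (\<forall>Z\<in>Obj C. \<forall>f\<in>homset C Z X. \<forall>g\<in>homset C Z Y.
        \<exists>!h. h \<in> homset C Z W \<and> p \<odot>\<^bsub>C\<^esub> h = f \<and> q \<odot>\<^bsub>C\<^esub> h = g)"

locale finite_product_category = category +
  assumes ex_terminal: "\<exists>t. terminal_object C t"
    and ex_product: "\<lbrakk>X \<in> Obj C; Y \<in> Obj C\<rbrakk> \<Longrightarrow> \<exists>W p q. product_cone C X Y W p q"

record ('o, 'm, 'o2, 'm2) cfunctor =
  omap :: "'o \<Rightarrow> 'o2"
  amap :: "'m \<Rightarrow> 'm2"

locale finite_product_functor =
  C: finite_product_category C + D: finite_product_category D
  for C :: "('o, 'm) cat" and D :: "('o2, 'm2) cat" +
  fixes F :: "('o, 'm, 'o2, 'm2) cfunctor"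
  assumes omap_Obj: "X \<in> Obj C \<Longrightarrow> omap F X \<in> Obj D"
    and amap_homset: "f \<in> homset C X Y \<Longrightarrow> amap F f \<in> homset D (omap F X) (omap F Y)"
    and amap_Idt: "X \<in> Obj C \<Longrightarrow> amap F (Idt C X) = Idt D (omap F X)"
    and amap_Cmp: "\<lbrakk>f \<in> homset C X Y; g \<in> homset C Y Z\<rbrakk>
        \<Longrightarrow> amap F (g \<odot>\<^bsub>C\<^esub> f) = amap F g \<odot>\<^bsub>D\<^esub> amap F f"
    and preserves_terminal: "terminal_object C t \<Longrightarrow> terminal_object D (omap F t)"
    and preserves_product: "product_cone C X Y W p q
        \<Longrightarrow> product_cone D (omap F X) (omap F Y) (omap F W) (amap F p) (amap F q)"


section \<open>Doctrines\<close>

record ('o, 'm, 'p) doctrine =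
  base :: "('o, 'm) cat"
  fib :: "'o \<Rightarrow> 'p gorder"
  reidx :: "'m \<Rightarrow> 'p \<Rightarrow> 'p"

locale doctrine =
  fixes P :: "('o, 'm, 'p) doctrine"
  assumes base_category: "finite_product_category (base P)"
    and fib_order: "X \<in> Obj (base P) \<Longrightarrow> partial_order (fib P X)"
    and reidx_closed: "f \<in> homset (base P) X Y
        \<Longrightarrow> reidx P f \<in> carrier (fib P Y) \<rightarrow> carrier (fib P X)"
    and reidx_mono: "f \<in> homset (base P) X Y \<Longrightarrow> isotone (fib P Y) (fib P X) (reidx P f)"
    and reidx_Idt: "\<lbrakk>X \<in> Obj (base P); \<alpha> \<in> carrier (fib P X)\<rbrakk>
        \<Longrightarrow> reidx P (Idt (base P) X) \<alpha> = \<alpha>"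
    and reidx_Cmp: "\<lbrakk>f \<in> homset (base P) X Y; g \<in> homset (base P) Y Z; \<alpha> \<in> carrier (fib P Z)\<rbrakk>
        \<Longrightarrow> reidx P (g \<odot>\<^bsub>base P\<^esub> f) \<alpha> = reidx P f (reidx P g \<alpha>)"

locale primary_doctrine = doctrine +
  assumes fib_meets: "X \<in> Obj (base P) \<Longrightarrow> lower_semilattice (fib P X)"
    and fib_top: "X \<in> Obj (base P) \<Longrightarrow> weak_partial_order_top (fib P X)"
    and reidx_top: "f \<in> homset (base P) X Y \<Longrightarrow> reidx P f \<top>\<^bsub>fib P Y\<^esub> = \<top>\<^bsub>fib P X\<^esub>"
    and reidx_meet: "\<lbrakk>f \<in> homset (base P) X Y; \<alpha> \<in> carrier (fib P Y); \<beta> \<in> carrier (fib P Y)\<rbrakk>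
        \<Longrightarrow> reidx P f (\<alpha> \<sqinter>\<^bsub>fib P Y\<^esub> \<beta>) = reidx P f \<alpha> \<sqinter>\<^bsub>fib P X\<^esub> reidx P f \<beta>"

locale bounded_doctrine = doctrine +
  assumes fib_top: "X \<in> Obj (base P) \<Longrightarrow> weak_partial_order_top (fib P X)"
    and fib_bottom: "X \<in> Obj (base P) \<Longrightarrow> weak_partial_order_bottom (fib P X)"
    and reidx_top: "f \<in> homset (base P) X Y \<Longrightarrow> reidx P f \<top>\<^bsub>fib P Y\<^esub> = \<top>\<^bsub>fib P X\<^esub>"
    and reidx_bottom: "f \<in> homset (base P) X Y \<Longrightarrow> reidx P f \<bottom>\<^bsub>fib P Y\<^esub> = \<bottom>\<^bsub>fib P X\<^esub>"

definition is_heyting_imp :: "'p gorder \<Rightarrow> 'p \<Rightarrow> 'p \<Rightarrow> 'p \<Rightarrow> bool" where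
  "is_heyting_imp L a b c \<longleftrightarrow>
     c \<in> carrier L \<and> (\<forall>x\<in>carrier L. x \<sqsubseteq>\<^bsub>L\<^esub> c \<longleftrightarrow> x \<sqinter>\<^bsub>L\<^esub> a \<sqsubseteq>\<^bsub>L\<^esub> b)"

definition heyting_imp :: "'p gorder \<Rightarrow> 'p \<Rightarrow> 'p \<Rightarrow> 'p" where
  "heyting_imp L a b = (THE c. is_heyting_imp L a b c)"

definition heyting_neg :: "'p gorder \<Rightarrow> 'p \<Rightarrow> 'p" where
  "heyting_neg L a = heyting_imp L a \<bottom>\<^bsub>L\<^esub>"

locale implicational_doctrine = primary_doctrine +
  assumes fib_imp: "\<lbrakk>X \<in> Obj (base P); \<alpha> \<in> carrier (fib P X); \<beta> \<in> carrier (fib P X)\<rbrakk>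
        \<Longrightarrow> \<exists>\<gamma>. is_heyting_imp (fib P X) \<alpha> \<beta> \<gamma>"
    and reidx_imp: "\<lbrakk>f \<in> homset (base P) X Y; \<alpha> \<in> carrier (fib P Y); \<beta> \<in> carrier (fib P Y)\<rbrakk>
        \<Longrightarrow> reidx P f (heyting_imp (fib P Y) \<alpha> \<beta>)
          = heyting_imp (fib P X) (reidx P f \<alpha>) (reidx P f \<beta>)"

definition left_adjoint_along :: "('o, 'm, 'p) doctrine \<Rightarrow> 'm \<Rightarrow> ('p \<Rightarrow> 'p) \<Rightarrow> bool" where
  "left_adjoint_along P p E \<longleftrightarrow>
     galois_connection \<lparr>orderA = fib P (Src (base P) p), orderB = fib P (Tgt (base P) p),
       lower = E, upper = reidx P p\<rparr>"

text \<open>A left adjoint is determined on the carrier only, hence \<open>SOME\<close>. Products are not chosen: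
  quantification is along the first leg of an arbitrary product cone.\<close>

definition exists_along :: "('o, 'm, 'p) doctrine \<Rightarrow> 'm \<Rightarrow> 'p \<Rightarrow> 'p" where
  "exists_along P p = (SOME E. left_adjoint_along P p E)"

locale existential_doctrine = primary_doctrine +
  assumes ex_left_adjoint: "product_cone (base P) C B W p q \<Longrightarrow> \<exists>E. left_adjoint_along P p E"
    and Beck_Chevalley: \<comment> \<open>\<open>h\<close> is the arrow \<open>f \<times> id\<close>\<close>
      "\<lbrakk>product_cone (base P) C B W p q; product_cone (base P) C' B W' p' q';
        f \<in> homset (base P) C C'; h \<in> homset (base P) W W';
        p' \<odot>\<^bsub>base P\<^esub> h = f \<odot>\<^bsub>base P\<^esub> p; q' \<odot>\<^bsub>base P\<^esub> h = q; \<alpha> \<in> carrier (fib P W')\<rbrakk>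
        \<Longrightarrow> exists_along P p (reidx P h \<alpha>) = reidx P f (exists_along P p' \<alpha>)"
    and Frobenius:
      "\<lbrakk>product_cone (base P) C B W p q; \<alpha> \<in> carrier (fib P W); \<beta> \<in> carrier (fib P C)\<rbrakk>
        \<Longrightarrow> exists_along P p (\<alpha> \<sqinter>\<^bsub>fib P W\<^esub> reidx P p \<beta>) = exists_along P p \<alpha> \<sqinter>\<^bsub>fib P C\<^esub> \<beta>"

definition consistent_doctrine :: "('o, 'm, 'p) doctrine \<Rightarrow> 'o \<Rightarrow> bool" where
  "consistent_doctrine P t \<longleftrightarrow>
     (\<exists>a\<in>carrier (fib P t). \<exists>b\<in>carrier (fib P t). \<not> a \<sqsubseteq>\<^bsub>fib P t\<^esub> b)"

text \<open>For \<open>\<sigma>\<close> in the fibre over \<open>A\<close> itself, the quantifier over \<open>A\<close> down to the terminal object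
  is the one given by the product cone with apex \<open>A\<close> and legs \<open>bang C t A\<close> and the identity.\<close>

locale rich_doctrine = existential_doctrine P
  for P :: "('o, 'm, 'p) doctrine" +
  fixes t :: 'o
  assumes rich: "\<lbrakk>A \<in> Obj (base P); \<sigma> \<in> carrier (fib P A)\<rbrakk>
        \<Longrightarrow> \<exists>d\<in>homset (base P) t A.
              exists_along P (bang (base P) t A) \<sigma> \<sqsubseteq>\<^bsub>fib P t\<^esub> reidx P d \<sigma>"


section \<open>Morphisms of doctrines\<close>

locale doctrine_morphism =
  P: doctrine P + R: doctrine R + finite_product_functor "base P" "base R" F
  for P :: "('o, 'm, 'p) doctrine" and R :: "('o2, 'm2, 'r) doctrine"
    and F :: "('o, 'm, 'o2, 'm2) cfunctor" +
  fixes \<ff> :: "'o \<Rightarrow> 'p \<Rightarrow> 'r"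
  assumes component_closed: "X \<in> Obj (base P)
        \<Longrightarrow> \<ff> X \<in> carrier (fib P X) \<rightarrow> carrier (fib R (omap F X))"
    and component_mono: "X \<in> Obj (base P) \<Longrightarrow> isotone (fib P X) (fib R (omap F X)) (\<ff> X)"
    and natural: "\<lbrakk>f \<in> homset (base P) X Y; \<beta> \<in> carrier (fib P Y)\<rbrakk>
        \<Longrightarrow> \<ff> X (reidx P f \<beta>) = reidx R (amap F f) (\<ff> Y \<beta>)"

locale bounded_morphism =
  doctrine_morphism + P: bounded_doctrine P + R: bounded_doctrine R +
  assumes preserves_top: "X \<in> Obj (base P) \<Longrightarrow> \<ff> X \<top>\<^bsub>fib P X\<^esub> = \<top>\<^bsub>fib R (omap F X)\<^esub>"
    and preserves_bottom: "X \<in> Obj (base P) \<Longrightarrow> \<ff> X \<bottom>\<^bsub>fib P X\<^esub> = \<bottom>\<^bsub>fib R (omap F X)\<^esub>"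

locale primary_morphism =
  doctrine_morphism + P: primary_doctrine P + R: primary_doctrine R +
  assumes preserves_top: "X \<in> Obj (base P) \<Longrightarrow> \<ff> X \<top>\<^bsub>fib P X\<^esub> = \<top>\<^bsub>fib R (omap F X)\<^esub>"
    and preserves_meet: "\<lbrakk>X \<in> Obj (base P); \<alpha> \<in> carrier (fib P X); \<beta> \<in> carrier (fib P X)\<rbrakk>
        \<Longrightarrow> \<ff> X (\<alpha> \<sqinter>\<^bsub>fib P X\<^esub> \<beta>) = \<ff> X \<alpha> \<sqinter>\<^bsub>fib R (omap F X)\<^esub> \<ff> X \<beta>"

locale implicational_morphism =
  primary_morphism + P: implicational_doctrine P + R: implicational_doctrine R +
  assumes preserves_imp: "\<lbrakk>X \<in> Obj (base P); \<alpha> \<in> carrier (fib P X); \<beta> \<in> carrier (fib P X)\<rbrakk>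
        \<Longrightarrow> \<ff> X (heyting_imp (fib P X) \<alpha> \<beta>)
          = heyting_imp (fib R (omap F X)) (\<ff> X \<alpha>) (\<ff> X \<beta>)"

locale existential_morphism =
  primary_morphism + P: existential_doctrine P + R: existential_doctrine R +
  assumes preserves_exists: "\<lbrakk>product_cone (base P) C B W p q; \<alpha> \<in> carrier (fib P W)\<rbrakk>
        \<Longrightarrow> \<ff> C (exists_along P p \<alpha>) = exists_along R (amap F p) (\<ff> W \<alpha>)"


section \<open>The subsets doctrine\<close>

text \<open>The non-empty sets are those of a universe \<open>'u\<close>; this category has binary products when
  \<open>'u\<close> is infinite. Arrows carry their domain and codomain.\<close>

definition set_star :: "('u set, 'u set \<times> ('u \<Rightarrow> 'u) \<times> 'u set) cat" where
  "set_star = \<lparr>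
     Obj = {A. A \<noteq> {}},
     Arr = {(A, f, B). A \<noteq> {} \<and> B \<noteq> {} \<and> f \<in> A \<rightarrow>\<^sub>E B},
     Src = (\<lambda>(A, f, B). A),
     Tgt = (\<lambda>(A, f, B). B),
     Idt = (\<lambda>A. (A, \<lambda>x\<in>A. x, A)),
     Cmp = (\<lambda>(B, g, Z) (A, f, B'). (A, compose A g f, Z))\<rparr>"

definition subsets_star ::
    "('u set, 'u set \<times> ('u \<Rightarrow> 'u) \<times> 'u set, 'u set) doctrine" where
  "subsets_star = \<lparr>
     base = set_star,
     fib = (\<lambda>A. \<lparr>carrier = Pow A, eq = (=), le = (\<subseteq>)\<rparr>),
     reidx = (\<lambda>(A, f, B) S. {x \<in> A. f x \<in> S})\<rparr>"


section \<open>Ultrafilters and quotient doctrines\<close>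

definition semilattice_filter :: "'p gorder \<Rightarrow> 'p set \<Rightarrow> bool" where
  "semilattice_filter L N \<longleftrightarrow>
     N \<subseteq> carrier L \<and> \<top>\<^bsub>L\<^esub> \<in> N \<and>
     (\<forall>a\<in>N. \<forall>b\<in>carrier L. a \<sqsubseteq>\<^bsub>L\<^esub> b \<longrightarrow> b \<in> N) \<and>
     (\<forall>a\<in>N. \<forall>b\<in>N. a \<sqinter>\<^bsub>L\<^esub> b \<in> N)"

definition semilattice_ultrafilter :: "'p gorder \<Rightarrow> 'p set \<Rightarrow> bool" where
  "semilattice_ultrafilter L N \<longleftrightarrow>
     semilattice_filter L N \<and> (\<forall>a\<in>carrier L. (a \<in> N) \<noteq> (heyting_neg L a \<in> N))"

definition filter_le ::
    "('o, 'm, 'p) doctrine \<Rightarrow> 'o \<Rightarrow> 'p set \<Rightarrow> 'o \<Rightarrow> 'p \<Rightarrow> 'p \<Rightarrow> bool" where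
  "filter_le P t N X \<alpha> \<beta> \<longleftrightarrow>
     (\<exists>\<theta>\<in>N. reidx P (bang (base P) t X) \<theta> \<sqinter>\<^bsub>fib P X\<^esub> \<alpha> \<sqsubseteq>\<^bsub>fib P X\<^esub> \<beta>)"

definition filter_eq ::
    "('o, 'm, 'p) doctrine \<Rightarrow> 'o \<Rightarrow> 'p set \<Rightarrow> 'o \<Rightarrow> ('p \<times> 'p) set" where
  "filter_eq P t N X = {(\<alpha>, \<beta>). \<alpha> \<in> carrier (fib P X) \<and> \<beta> \<in> carrier (fib P X) \<and>
     filter_le P t N X \<alpha> \<beta> \<and> filter_le P t N X \<beta> \<alpha>}"

definition filter_class ::
    "('o, 'm, 'p) doctrine \<Rightarrow> 'o \<Rightarrow> 'p set \<Rightarrow> 'o \<Rightarrow> 'p \<Rightarrow> 'p set" where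
  "filter_class P t N X \<alpha> = filter_eq P t N X `` {\<alpha>}"

text \<open>Maps out of the quotient are written as unions over all representatives of the class.\<close>

definition quotient_doctrine ::
    "('o, 'm, 'p) doctrine \<Rightarrow> 'o \<Rightarrow> 'p set \<Rightarrow> ('o, 'm, 'p set) doctrine" where
  "quotient_doctrine P t N = \<lparr>
     base = base P,
     fib = (\<lambda>X. \<lparr>carrier = carrier (fib P X) // filter_eq P t N X,
                 eq = (=),
                 le = (\<lambda>a b. \<exists>\<alpha>\<in>a. \<exists>\<beta>\<in>b. filter_le P t N X \<alpha> \<beta>)\<rparr>),
     reidx = (\<lambda>f a. \<Union>\<alpha>\<in>a. filter_class P t N (Src (base P) f) (reidx P f \<alpha>))\<rparr>"


section \<open>Global points\<close>

text \<open>The map \<open>\<iota>\<close> embeds each set of global points into the universe \<open>'u\<close> of \<open>set_star\<close>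
  (local smallness); if the arrows already live in \<open>'u\<close> it can be the identity.\<close>

definition global_points ::
    "('m \<Rightarrow> 'u) \<Rightarrow> ('o, 'm) cat \<Rightarrow> 'o \<Rightarrow> ('o, 'm, 'u set, 'u set \<times> ('u \<Rightarrow> 'u) \<times> 'u set) cfunctor"
  where
  "global_points \<iota> C t = \<lparr>
     omap = (\<lambda>X. \<iota> ` homset C t X),
     amap = (\<lambda>f. (\<iota> ` homset C t (Src C f),
                  \<lambda>u\<in>\<iota> ` homset C t (Src C f). \<iota> (f \<odot>\<^bsub>C\<^esub> inv_into (homset C t (Src C f)) \<iota> u),
                  \<iota> ` homset C t (Tgt C f)))\<rparr>"

definition truth_points ::
    "('m \<Rightarrow> 'u) \<Rightarrow> ('o, 'm, 'p) doctrine \<Rightarrow> 'o \<Rightarrow> 'p set \<Rightarrow> 'o \<Rightarrow> 'p set \<Rightarrow> 'u set" where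
  "truth_points \<iota> P t N X a = (\<Union>\<phi>\<in>a. \<iota> ` {c \<in> homset (base P) t X. reidx P c \<phi> \<in> N})"

end

theory Submission
  imports Defs
begin

text \<open>Meets, implication and quantifiers of the quotient are computed on representatives: by
  Frobenius, a constant \<open>\<theta>\<close> taken from the filter can be moved through a quantifier. Reindexing
  along a point of \<open>X\<close> lands in the fibre over the terminal object, where the ultrafilter is a
  two-valued truth assignment; this gives the preservation of the propositional
  structure. For the quantifiers, Beck--Chevalley along a point \<open>c\<close> turns \<open>\<exists>\<alpha>\<close> into a quantifier
  over the terminal object, and richness provides a witness there.\<close>

section \<open>Order-theoretic preliminaries\<close>

text \<open>Meets, implications and quantifiers are descriptions (\<open>SOME\<close>,
  \<open>THE\<close>), and a left adjoint is determined on the carrier only. Hence each preservation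
  equation rests on two computations, one on classes of formulas and one on subsets, and both work
  by exhibiting an element with the defining property and using antisymmetry. Products are arbitrary
  cones rather than chosen ones, so cones in \<open>set_star\<close> need a pointwise description
  before anything can be said about quantifiers there. Sets of points live in the universe
  \<open>'u\<close> only through the encoding \<open>\<iota>\<close>. Its injectivity on each
  hom-set is what lets direct images commute with intersection and implication. Besides giving
  witnesses, richness applied to \<open>\<top>\<close> gives every object a point, so that the
  global points form non-empty sets. The quotient is built for an arbitrary filter. The ultrafilter
  condition enters where an intuitionistic implication has to become a classical conditional, and
  where falsity has to hold at no point.\<close>

context partial_order
begin

lemma top_eqI: "\<lbrakk>a \<in> carrier L; \<And>x. x \<in> carrier L \<Longrightarrow> x \<sqsubseteq> a\<rbrakk> \<Longrightarrow> \<top> = a"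
  unfolding top_def
  by (rule some_equality) (auto simp: greatest_def)

lemma bottom_eqI: "\<lbrakk>a \<in> carrier L; \<And>x. x \<in> carrier L \<Longrightarrow> a \<sqsubseteq> x\<rbrakk> \<Longrightarrow> \<bottom> = a"
  unfolding bottom_def
  by (rule some_equality) (auto simp: least_def)

lemma greatest_Lower_pairI:
  "\<lbrakk>z \<in> carrier L; z \<sqsubseteq> x; z \<sqsubseteq> y; \<And>w. \<lbrakk>w \<in> carrier L; w \<sqsubseteq> x; w \<sqsubseteq> y\<rbrakk> \<Longrightarrow> w \<sqsubseteq> z;
    x \<in> carrier L; y \<in> carrier L\<rbrakk> \<Longrightarrow> greatest L z (Lower L {x, y})"
  by (auto simp: greatest_def Lower_def)

text \<open>\<open>\<sqinter>\<close> is a Hilbert choice among greatest lower bounds; antisymmetry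
  leaves only one, so any element with the universal property is the chosen one.\<close>

lemma meet_eqI:
  assumes "z \<in> carrier L" "z \<sqsubseteq> x" "z \<sqsubseteq> y" "x \<in> carrier L" "y \<in> carrier L"
    and "\<And>w. \<lbrakk>w \<in> carrier L; w \<sqsubseteq> x; w \<sqsubseteq> y\<rbrakk> \<Longrightarrow> w \<sqsubseteq> z"
  shows "x \<sqinter> y = z"
proof -
  have z: "greatest L z (Lower L {x, y})"
    by (rule greatest_Lower_pairI) (use assms in auto)
  show ?thesis
    unfolding meet_def inf_def
  proof (rule some_equality)
    show "greatest L z (Lower L {x, y})" by fact
  next
    fix w assume "greatest L w (Lower L {x, y})"
    with z show "w = z"
      using greatest_unique by blast
  qed
qed

end

text \<open>Each candidate lies below itself, so its own characterisation yields the inequality that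
  places it below the other candidate.\<close>

lemma heyting_imp_eqI:
  assumes "partial_order L" and "is_heyting_imp L a b c"
  shows "heyting_imp L a b = c"
  unfolding heyting_imp_def
proof (rule the_equality)
  show "is_heyting_imp L a b c" by fact
next
  interpret partial_order L by fact
  fix d assume d: "is_heyting_imp L a b d"
  then have "d \<sqsubseteq>\<^bsub>L\<^esub> c" "c \<sqsubseteq>\<^bsub>L\<^esub> d"
    using assms(2) unfolding is_heyting_imp_def by auto
  with d assms(2) show "d = c"
    unfolding is_heyting_imp_def by (auto intro: le_antisym)
qed

text \<open>The adjoint picked by \<open>SOME\<close> may differ from \<open>E\<close> outside the
  carrier, hence the hypothesis on \<open>\<alpha>\<close>. On the carrier each value is below the
  other: the unit of one adjunction is transposed along the other.\<close>

lemma exists_along_eqI: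
  assumes "left_adjoint_along P p E" and "\<alpha> \<in> carrier (fib P (Src (base P) p))"
  shows "exists_along P p \<alpha> = E \<alpha>"
proof -
  let ?G = "\<lambda>E. \<lparr>orderA = fib P (Src (base P) p), orderB = fib P (Tgt (base P) p),
       lower = E, upper = reidx P p\<rparr>"
  have "left_adjoint_along P p (exists_along P p)"
    unfolding exists_along_def by (rule someI[of "left_adjoint_along P p"]) fact
  then interpret E': galois_connection "?G (exists_along P p)"
    unfolding left_adjoint_along_def .
  interpret E: galois_connection "?G E"
    using assms(1) unfolding left_adjoint_along_def .
  interpret partial_order "fib P (Tgt (base P) p)"
    using E.is_order_B by simp
  have cl: "E \<alpha> \<in> carrier (fib P (Tgt (base P) p))"
    "exists_along P p \<alpha> \<in> carrier (fib P (Tgt (base P) p))"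
    using E.lower_closed E'.lower_closed assms(2) by auto
  have "exists_along P p \<alpha> \<sqsubseteq>\<^bsub>fib P (Tgt (base P) p)\<^esub> E \<alpha>"
    using E'.left[of \<alpha> "E \<alpha>"] E.inflation[of \<alpha>] cl assms(2) by simp
  moreover have "E \<alpha> \<sqsubseteq>\<^bsub>fib P (Tgt (base P) p)\<^esub> exists_along P p \<alpha>"
    using E.left[of \<alpha> "exists_along P p \<alpha>"] E'.inflation[of \<alpha>] cl assms(2) by simp
  ultimately show ?thesis
    using cl by (intro le_antisym)
qed

section \<open>The subsets doctrine\<close>

abbreviation set_fun :: "'a \<times> 'b \<times> 'c \<Rightarrow> 'b" where
  "set_fun f \<equiv> fst (snd f)"

lemma set_star_simps [simp]:
  "A \<in> Obj set_star \<longleftrightarrow> A \<noteq> {}"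
  "Src set_star (A, f, B) = A"
  "Tgt set_star (A, f, B) = B"
  "Idt set_star A = (A, \<lambda>x\<in>A. x, A)"
  "(B', g, Z) \<odot>\<^bsub>set_star\<^esub> (A, f, B) = (A, compose A g f, Z)"
  by (auto simp: set_star_def)

lemma homset_set_star:
  "f \<in> homset set_star A B \<longleftrightarrow> A \<noteq> {} \<and> B \<noteq> {} \<and> (\<exists>g \<in> A \<rightarrow>\<^sub>E B. f = (A, g, B))"
  by (cases f) (auto simp: homset_def set_star_def)

lemma homset_set_starI:
  "\<lbrakk>g \<in> A \<rightarrow>\<^sub>E B; A \<noteq> {}; B \<noteq> {}\<rbrakk> \<Longrightarrow> (A, g, B) \<in> homset set_star A B"
  by (auto simp: homset_set_star)

lemma homset_set_starE:
  assumes "f \<in> homset set_star A B"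
  obtains g where "f = (A, g, B)" "g \<in> A \<rightarrow>\<^sub>E B" "A \<noteq> {}" "B \<noteq> {}"
  using assms by (auto simp: homset_set_star)

lemma category_set_star: "category set_star"
proof
  fix f :: "'a set \<times> ('a \<Rightarrow> 'a) \<times> 'a set"
  assume "f \<in> Arr set_star"
  then show "Src set_star f \<in> Obj set_star" "Tgt set_star f \<in> Obj set_star"
    by (auto simp: set_star_def)
next
  fix X :: "'a set" assume "X \<in> Obj set_star"
  then show "Idt set_star X \<in> homset set_star X X"
    by (auto simp: homset_set_star)
next
  fix f g and X Y Z :: "'a set"
  assume "f \<in> homset set_star X Y" "g \<in> homset set_star Y Z"
  then show "g \<odot>\<^bsub>set_star\<^esub> f \<in> homset set_star X Z"
    by (auto simp: homset_set_star compose_def PiE_iff)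
next
  fix f and X Y :: "'a set"
  assume "f \<in> homset set_star X Y"
  then show "Idt set_star Y \<odot>\<^bsub>set_star\<^esub> f = f" "f \<odot>\<^bsub>set_star\<^esub> Idt set_star X = f"
    by (auto simp: homset_set_star compose_def PiE_iff extensional_def fun_eq_iff split: if_splits)
next
  fix f g h and W X Y Z :: "'a set"
  assume "f \<in> homset set_star W X" "g \<in> homset set_star X Y" "h \<in> homset set_star Y Z"
  then show "(h \<odot>\<^bsub>set_star\<^esub> g) \<odot>\<^bsub>set_star\<^esub> f = h \<odot>\<^bsub>set_star\<^esub> (g \<odot>\<^bsub>set_star\<^esub> f)"
    by (auto simp: homset_set_star compose_def PiE_iff fun_eq_iff split: if_splits)
qed

lemma terminal_set_star: "terminal_object set_star {a}"
  unfolding terminal_object_def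
proof (intro conjI ballI)
  fix X :: "'a set" assume X: "X \<in> Obj set_star"
  show "\<exists>!f. f \<in> homset set_star X {a}"
  proof (rule ex1I[of _ "(X, \<lambda>x\<in>X. a, {a})"])
    fix f assume "f \<in> homset set_star X {a}"
    then show "f = (X, \<lambda>x\<in>X. a, {a})"
      by (auto elim!: homset_set_starE simp: PiE_iff extensional_def fun_eq_iff)
  qed (use X in \<open>auto simp: homset_set_star\<close>)
qed auto

text \<open>A cone is a product exactly when its two legs are jointly bijective. One direction tests
  the universal property on a singleton; the other assembles mediating arrows pointwise.
  Non-emptiness of the three sets is contained in the hom-set conditions on the legs.\<close>

lemma product_cone_set_star_iff:
  "product_cone set_star A B W p q \<longleftrightarrow>
     p \<in> homset set_star W A \<and> q \<in> homset set_star W B \<and>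
     (\<forall>a\<in>A. \<forall>b\<in>B. \<exists>!w. w \<in> W \<and> set_fun p w = a \<and> set_fun q w = b)"
  (is "?cone \<longleftrightarrow> ?p \<and> ?q \<and> ?univ")
proof (intro iffI conjI ballI)
  assume ?cone
  then show p: ?p and q: ?q
    by (auto simp: product_cone_def)
  fix a b assume ab: "a \<in> A" "b \<in> B"
  obtain f g where fg: "p = (W, f, A)" "q = (W, g, B)" "f \<in> W \<rightarrow>\<^sub>E A" "g \<in> W \<rightarrow>\<^sub>E B" "W \<noteq> {}"
    using p q by (auto elim!: homset_set_starE)
  \<comment> \<open>Elements of a set are arrows out of a singleton; \<open>{a}\<close> is a
    singleton at hand in the universe.\<close>
  let ?c = "\<lambda>x Y. ({a}, \<lambda>_\<in>{a}. x, Y)"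
  have "?c a A \<in> homset set_star {a} A" "?c b B \<in> homset set_star {a} B"
    using ab by (auto simp: homset_set_star)
  then have "\<exists>!h. h \<in> homset set_star {a} W \<and> p \<odot>\<^bsub>set_star\<^esub> h = ?c a A
      \<and> q \<odot>\<^bsub>set_star\<^esub> h = ?c b B"
    using \<open>?cone\<close> unfolding product_cone_def by auto
  then obtain k where k: "k \<in> homset set_star {a} W" "p \<odot>\<^bsub>set_star\<^esub> k = ?c a A"
      "q \<odot>\<^bsub>set_star\<^esub> k = ?c b B"
    and unique: "\<And>k'. \<lbrakk>k' \<in> homset set_star {a} W; p \<odot>\<^bsub>set_star\<^esub> k' = ?c a A;
      q \<odot>\<^bsub>set_star\<^esub> k' = ?c b B\<rbrakk> \<Longrightarrow> k' = k"
    by (elim ex1E) blast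
  obtain h where h: "k = ({a}, h, W)" "h \<in> {a} \<rightarrow>\<^sub>E W"
    using k(1) by (rule homset_set_starE)
  show "\<exists>!w. w \<in> W \<and> set_fun p w = a \<and> set_fun q w = b"
  proof (rule ex1I[of _ "h a"])
    show "h a \<in> W \<and> set_fun p (h a) = a \<and> set_fun q (h a) = b"
      using k(2,3) h(2) by (auto simp: h(1) fg compose_def fun_eq_iff split: if_splits)
  next
    fix w assume w: "w \<in> W \<and> set_fun p w = a \<and> set_fun q w = b"
    have "(\<lambda>_\<in>{a}. w) \<in> {a} \<rightarrow>\<^sub>E W"
      using w by (simp only: restrict_PiE_iff) simp
    then have "?c w W \<in> homset set_star {a} W"
      using w by (intro homset_set_starI) auto
    moreover have "p \<odot>\<^bsub>set_star\<^esub> ?c w W = ?c a A" "q \<odot>\<^bsub>set_star\<^esub> ?c w W = ?c b B"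
      using w by (auto simp: fg compose_def fun_eq_iff)
    ultimately have "?c w W = ({a}, h, W)"
      using unique h(1) by simp
    then have "(\<lambda>_\<in>{a}. w) a = h a"
      by simp
    then show "w = h a"
      by simp
  qed
next
  assume *: "?p \<and> ?q \<and> ?univ"
  then obtain f g where fg: "p = (W, f, A)" "q = (W, g, B)" "f \<in> W \<rightarrow>\<^sub>E A" "g \<in> W \<rightarrow>\<^sub>E B"
      "W \<noteq> {}" "A \<noteq> {}" "B \<noteq> {}"
    by (auto elim!: homset_set_starE)
  \<comment> \<open>The inverse of the bijection sending \<open>w\<close> to the pair of
    \<open>f w\<close> and \<open>g w\<close>; it supplies the mediating arrows.\<close>
  define pair where "pair a b = (THE w. w \<in> W \<and> f w = a \<and> g w = b)" for a b
  have pair: "pair a b \<in> W \<and> f (pair a b) = a \<and> g (pair a b) = b" if "a \<in> A" "b \<in> B" for a b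
    unfolding pair_def by (rule theI') (use * that in \<open>auto simp: fg\<close>)
  have pair_unique: "w = w'" if "w \<in> W" "w' \<in> W" "f w = f w'" "g w = g w'" for w w'
  proof -
    have "f w \<in> A" "g w \<in> B"
      using that fg by auto
    then have "\<exists>!v. v \<in> W \<and> f v = f w \<and> g v = g w"
      using * by (simp add: fg)
    with that show ?thesis
      by metis
  qed
  have "\<exists>!h. h \<in> homset set_star Z W \<and> p \<odot>\<^bsub>set_star\<^esub> h = x \<and> q \<odot>\<^bsub>set_star\<^esub> h = y"
    if xy: "x \<in> homset set_star Z A" "y \<in> homset set_star Z B" for Z x y
  proof -
    obtain u v where uv: "x = (Z, u, A)" "y = (Z, v, B)" "u \<in> Z \<rightarrow>\<^sub>E A" "v \<in> Z \<rightarrow>\<^sub>E B" "Z \<noteq> {}"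
      using xy by (auto elim!: homset_set_starE)
    let ?r = "\<lambda>z\<in>Z. pair (u z) (v z)"
    have uv_mem: "u z \<in> A" "v z \<in> B" if "z \<in> Z" for z
      using uv(3,4) that by auto
    have r: "?r \<in> Z \<rightarrow>\<^sub>E W"
      using pair uv_mem by auto
    \<comment> \<open>Arrows are extensional functions, undefined off their domain, so a composite
      need only be compared with its target on \<open>Z\<close>.\<close>
    have eqI: "compose Z k' r' = w" if "w \<in> Z \<rightarrow>\<^sub>E D" "\<And>z. z \<in> Z \<Longrightarrow> k' (r' z) = w z"
      for k' :: "'a \<Rightarrow> 'a" and r' :: "'a \<Rightarrow> 'a" and w D
      by (rule extensionalityI[of _ Z]) (use that in \<open>auto simp: compose_def PiE_iff\<close>)
    have comp: "compose Z f ?r = u" "compose Z g ?r = v"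
      using uv(3,4) by (auto intro!: eqI simp: pair uv_mem)
    show ?thesis
    proof (rule ex1I[of _ "(Z, ?r, W)"])
      show "(Z, ?r, W) \<in> homset set_star Z W \<and>
          p \<odot>\<^bsub>set_star\<^esub> (Z, ?r, W) = x \<and> q \<odot>\<^bsub>set_star\<^esub> (Z, ?r, W) = y"
        using comp r uv(5) fg(5) by (simp add: homset_set_starI uv(1,2) fg(1,2))
    next
      fix h assume h: "h \<in> homset set_star Z W \<and> p \<odot>\<^bsub>set_star\<^esub> h = x \<and> q \<odot>\<^bsub>set_star\<^esub> h = y"
      then obtain k where k: "h = (Z, k, W)" "k \<in> Z \<rightarrow>\<^sub>E W"
        by (auto elim!: homset_set_starE)
      have comp_k: "compose Z f k = u" "compose Z g k = v"
        using h by (auto simp: k fg(1,2) uv(1,2))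
      have "k = ?r"
      proof (rule extensionalityI[of _ Z])
        fix z assume z: "z \<in> Z"
        then have "f (k z) = u z" "g (k z) = v z"
          unfolding comp_k[symmetric] by (simp_all add: compose_def)
        moreover have "k z \<in> W"
          using k z by auto
        ultimately have "k z = pair (u z) (v z)"
          using pair[OF uv_mem[OF z]] by (simp add: pair_unique)
        with z show "k z = ?r z"
          by simp
      qed (use k in \<open>auto simp: PiE_iff\<close>)
      then show "h = (Z, ?r, W)"
        by (simp add: k)
    qed
  qed
  with * show ?cone
    unfolding product_cone_def by (auto simp: fg)
qed

text \<open>Cardinal arithmetic: the square of an infinite cardinal is that cardinal. The injection
  codes pairs as elements of the universe, so that binary products exist without leaving it.\<close>

lemma ex_inj_Times_infinite: "\<exists>j :: 'u::infinite \<times> 'u \<Rightarrow> 'u. inj j"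
  using card_of_Times_same_infinite[OF infinite_UNIV[where 'a = 'u]]
    card_of_ordIso[of "UNIV :: ('u \<times> 'u) set" "UNIV :: 'u set"]
  by (auto simp: bij_betw_def)

lemma finite_product_category_set_star:
  "finite_product_category (set_star :: ('u::infinite set, _) cat)"
proof -
  interpret category set_star
    by (rule category_set_star)
  show ?thesis
  proof
    show "\<exists>t :: 'u set. terminal_object set_star t"
      by (rule exI) (rule terminal_set_star)
  next
    fix A B :: "'u set" assume AB: "A \<in> Obj set_star" "B \<in> Obj set_star"
    obtain j :: "'u \<times> 'u \<Rightarrow> 'u" where j: "inj j"
      using ex_inj_Times_infinite by blast
    \<comment> \<open>The cartesian product itself has the wrong type; its image under the pairing
      code is the product object, with decoding as projections.\<close>
    let ?W = "j ` (A \<times> B)"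
    have "product_cone set_star A B ?W (?W, \<lambda>w\<in>?W. fst (inv j w), A) (?W, \<lambda>w\<in>?W. snd (inv j w), B)"
      unfolding product_cone_set_star_iff
    proof (intro conjI ballI)
      fix a b assume "a \<in> A" "b \<in> B"
      with j show "\<exists>!w. w \<in> ?W \<and> set_fun (?W, \<lambda>w\<in>?W. fst (inv j w), A) w = a
          \<and> set_fun (?W, \<lambda>w\<in>?W. snd (inv j w), B) w = b"
        by (intro ex1I[of _ "j (a, b)"]) auto
    qed (use AB j in \<open>auto simp: homset_set_star\<close>)
    then show "\<exists>W p q. product_cone set_star A B W p q"
      by blast
  qed
qed

section \<open>Fibres, reindexing and direct images of the subsets doctrine\<close>

lemma subsets_star_simps [simp]:
  "base subsets_star = set_star"
  "carrier (fib subsets_star A) = Pow A"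
  "S \<sqsubseteq>\<^bsub>fib subsets_star A\<^esub> T \<longleftrightarrow> S \<subseteq> T"
  "reidx subsets_star (A, f, B) S = {x \<in> A. f x \<in> S}"
  by (auto simp: subsets_star_def)

lemma partial_order_subsets_star: "partial_order (fib subsets_star A)"
  by unfold_locales (auto simp: subsets_star_def)

lemma meet_subsets_star [simp]:
  "\<lbrakk>S \<subseteq> A; T \<subseteq> A\<rbrakk> \<Longrightarrow> S \<sqinter>\<^bsub>fib subsets_star A\<^esub> T = S \<inter> T"
  by (rule partial_order.meet_eqI[OF partial_order_subsets_star]) auto

lemma top_subsets_star [simp]: "\<top>\<^bsub>fib subsets_star A\<^esub> = A"
  by (rule partial_order.top_eqI[OF partial_order_subsets_star]) auto

lemma bottom_subsets_star [simp]: "\<bottom>\<^bsub>fib subsets_star A\<^esub> = {}"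
  by (rule partial_order.bottom_eqI[OF partial_order_subsets_star]) auto

lemma is_heyting_imp_subsets_star:
  "\<lbrakk>S \<subseteq> A; T \<subseteq> A\<rbrakk> \<Longrightarrow> is_heyting_imp (fib subsets_star A) S T {x \<in> A. x \<in> S \<longrightarrow> x \<in> T}"
  by (auto simp: is_heyting_imp_def)

lemma heyting_imp_subsets_star:
  "\<lbrakk>S \<subseteq> A; T \<subseteq> A\<rbrakk> \<Longrightarrow> heyting_imp (fib subsets_star A) S T = {x \<in> A. x \<in> S \<longrightarrow> x \<in> T}"
  by (rule heyting_imp_eqI[OF partial_order_subsets_star is_heyting_imp_subsets_star])

text \<open>Direct image is left adjoint to inverse image along every function, so no product
  structure is used here; cones matter only for Beck--Chevalley.\<close>

lemma left_adjoint_along_subsets_star: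
  "p \<in> homset set_star W A \<Longrightarrow> left_adjoint_along subsets_star p ((`) (set_fun p))"
  unfolding left_adjoint_along_def
  by (erule homset_set_starE, intro galois_connection.intro connection.intro
      galois_connection_axioms.intro) (auto simp: partial_order_subsets_star)

lemma exists_along_subsets_star:
  "\<lbrakk>p \<in> homset set_star W A; S \<subseteq> W\<rbrakk> \<Longrightarrow> exists_along subsets_star p S = set_fun p ` S"
  by (rule exists_along_eqI[OF left_adjoint_along_subsets_star])
    (auto elim!: homset_set_starE)

lemma doctrine_subsets_star: "doctrine (subsets_star :: ('u::infinite set, _, _) doctrine)"
proof (rule doctrine.intro)
  show "finite_product_category (base (subsets_star :: ('u set, _, _) doctrine))"
    by (simp add: finite_product_category_set_star)
next
  fix f and X Y :: "'u set" assume f: "f \<in> homset (base subsets_star) X Y"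
  show "isotone (fib subsets_star Y) (fib subsets_star X) (reidx subsets_star f)"
    using f partial_order_subsets_star[THEN partial_order.axioms(1)]
    by (auto elim!: homset_set_starE simp: isotone_def)
qed (auto elim!: homset_set_starE simp: partial_order_subsets_star compose_def)

lemma implicational_subsets_star:
  "implicational_doctrine (subsets_star :: ('u::infinite set, _, _) doctrine)"
proof -
  interpret doctrine "subsets_star :: ('u set, _, _) doctrine"
    by (rule doctrine_subsets_star)
  show ?thesis
  proof (intro primary_doctrine.intro primary_doctrine_axioms.intro implicational_doctrine.intro
      implicational_doctrine_axioms.intro doctrine_axioms)
    fix X :: "'u set"
    interpret X: partial_order "fib subsets_star X"
      by (rule partial_order_subsets_star)
    show "lower_semilattice (fib subsets_star X)"
    proof
      fix S T assume "S \<in> carrier (fib subsets_star X)" "T \<in> carrier (fib subsets_star X)"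
      then have "greatest (fib subsets_star X) (S \<inter> T) (Lower (fib subsets_star X) {S, T})"
        by (intro X.greatest_Lower_pairI) auto
      then show "\<exists>s. greatest (fib subsets_star X) s (Lower (fib subsets_star X) {S, T})" ..
    qed
    show "weak_partial_order_top (fib subsets_star X)"
      by unfold_locales (auto simp: greatest_def intro!: exI[of _ X])
  qed (auto elim!: homset_set_starE simp: heyting_imp_subsets_star
      intro: is_heyting_imp_subsets_star)
qed

lemma bounded_subsets_star:
  "bounded_doctrine (subsets_star :: ('u::infinite set, _, _) doctrine)"
proof -
  interpret implicational_doctrine "subsets_star :: ('u set, _, _) doctrine"
    by (rule implicational_subsets_star)
  show ?thesis
  proof (intro bounded_doctrine.intro bounded_doctrine_axioms.intro doctrine_axioms)
    fix X :: "'u set"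
    interpret X: partial_order "fib subsets_star X"
      by (rule partial_order_subsets_star)
    show "weak_partial_order_bottom (fib subsets_star X)"
      by unfold_locales (auto simp: least_def intro!: exI[of _ "{}"])
  qed (auto intro: fib_top reidx_top elim!: homset_set_starE)
qed

lemma existential_subsets_star:
  "existential_doctrine (subsets_star :: ('u::infinite set, _, _) doctrine)"
proof -
  interpret implicational_doctrine "subsets_star :: ('u set, _, _) doctrine"
    by (rule implicational_subsets_star)
  show ?thesis
  proof (intro existential_doctrine.intro existential_doctrine_axioms.intro
      primary_doctrine_axioms)
    fix C B W :: "'u set" and p q
    assume "product_cone (base subsets_star) C B W p q"
    then show "\<exists>E. left_adjoint_along subsets_star p E"
      by (auto simp: product_cone_set_star_iff intro: left_adjoint_along_subsets_star)
  next
    fix C B W C' W' :: "'u set" and p q p' q' f h \<alpha>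
    assume cones: "product_cone (base subsets_star) C B W p q"
        "product_cone (base subsets_star) C' B W' p' q'"
      and fh: "f \<in> homset (base subsets_star) C C'" "h \<in> homset (base subsets_star) W W'"
        "p' \<odot>\<^bsub>base subsets_star\<^esub> h = f \<odot>\<^bsub>base subsets_star\<^esub> p"
        "q' \<odot>\<^bsub>base subsets_star\<^esub> h = q"
      and \<alpha>: "\<alpha> \<in> carrier (fib subsets_star W')"
    from cones have hom: "p \<in> homset set_star W C" "q \<in> homset set_star W B"
        "p' \<in> homset set_star W' C'" "q' \<in> homset set_star W' B"
      and univ: "\<And>c b. \<lbrakk>c \<in> C; b \<in> B\<rbrakk> \<Longrightarrow> \<exists>!w. w \<in> W \<and> set_fun p w = c \<and> set_fun q w = b"
      and univ': "\<And>c b. \<lbrakk>c \<in> C'; b \<in> B\<rbrakk> \<Longrightarrow> \<exists>!w. w \<in> W' \<and> set_fun p' w = c \<and> set_fun q' w = b"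
      unfolding product_cone_set_star_iff subsets_star_simps by blast+
    obtain p0 q0 where pq: "p = (W, p0, C)" "q = (W, q0, B)" "p0 \<in> W \<rightarrow>\<^sub>E C" "q0 \<in> W \<rightarrow>\<^sub>E B"
      using hom(1,2) by (auto elim!: homset_set_starE)
    obtain p0' q0' where pq': "p' = (W', p0', C')" "q' = (W', q0', B)"
        "p0' \<in> W' \<rightarrow>\<^sub>E C'" "q0' \<in> W' \<rightarrow>\<^sub>E B"
      using hom(3,4) by (auto elim!: homset_set_starE)
    obtain f0 h0 where fh0: "f = (C, f0, C')" "h = (W, h0, W')" "f0 \<in> C \<rightarrow>\<^sub>E C'" "h0 \<in> W \<rightarrow>\<^sub>E W'"
      using fh(1,2) by (auto elim!: homset_set_starE)
    note eqs = pq(1,2) pq'(1,2) fh0(1,2) and fns = pq(3,4) pq'(3,4) fh0(3,4)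
    have comm: "p0' (h0 w) = f0 (p0 w)" "q0' (h0 w) = q0 w" if "w \<in> W" for w
      using fh(3,4) that by (auto simp: eqs compose_def fun_eq_iff split: if_splits)
    have "p0 ` {w \<in> W. h0 w \<in> \<alpha>} = {c \<in> C. f0 c \<in> p0' ` \<alpha>}"
    proof (intro equalityI subsetI)
      fix c assume "c \<in> {c \<in> C. f0 c \<in> p0' ` \<alpha>}"
      then obtain w' where c: "c \<in> C" "w' \<in> \<alpha>" "f0 c = p0' w'"
        by auto
      with \<alpha> have w': "w' \<in> W'" by auto
      then have "q0' w' \<in> B" "p0' w' \<in> C'"
        using fns by auto
      \<comment> \<open>The square is a pullback: the point of \<open>W\<close> with coordinates
        \<open>c\<close> and \<open>q0' w'\<close> is sent by \<open>h0\<close> to a point with the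
        same coordinates as \<open>w'\<close>, hence to \<open>w'\<close> itself.\<close>
      then obtain w where w: "w \<in> W" "p0 w = c" "q0 w = q0' w'"
        using univ[OF c(1), of "q0' w'"] by (auto simp: eqs)
      have "\<exists>!v. v \<in> W' \<and> p0' v = p0' w' \<and> q0' v = q0' w'"
        using univ'[OF \<open>p0' w' \<in> C'\<close> \<open>q0' w' \<in> B\<close>] by (simp add: eqs)
      moreover have "h0 w \<in> W'" "p0' (h0 w) = p0' w'" "q0' (h0 w) = q0' w'"
        using comm[OF w(1)] w c fns by auto
      ultimately have "h0 w = w'"
        using w' by metis
      with w c show "c \<in> p0 ` {w \<in> W. h0 w \<in> \<alpha>}"
        by auto
    qed (use fns comm[symmetric] in auto)
    moreover have "{w \<in> W. h0 w \<in> \<alpha>} \<subseteq> W" "\<alpha> \<subseteq> W'"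
      using \<alpha> by auto
    ultimately show "exists_along subsets_star p (reidx subsets_star h \<alpha>)
        = reidx subsets_star f (exists_along subsets_star p' \<alpha>)"
      using exists_along_subsets_star[OF hom(1)] exists_along_subsets_star[OF hom(3)]
      by (simp add: eqs)
  next
    fix C B W :: "'u set" and p q \<alpha> \<beta>
    assume cone: "product_cone (base subsets_star) C B W p q"
      and \<alpha>: "\<alpha> \<in> carrier (fib subsets_star W)" and \<beta>: "\<beta> \<in> carrier (fib subsets_star C)"
    from cone have p: "p \<in> homset set_star W C"
      by (simp add: product_cone_set_star_iff)
    then obtain p0 where p0: "p = (W, p0, C)" "p0 \<in> W \<rightarrow>\<^sub>E C"
      by (auto elim!: homset_set_starE)
    \<comment> \<open>The two inclusions are side conditions for evaluating the meet and the
      quantifier; what remains is the projection formula for direct images.\<close>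
    have "p0 ` \<alpha> \<subseteq> C"
      using \<alpha> p0 by auto
    moreover have "\<alpha> \<inter> {w \<in> W. p0 w \<in> \<beta>} \<subseteq> W"
      by auto
    ultimately show "exists_along subsets_star p (\<alpha> \<sqinter>\<^bsub>fib subsets_star W\<^esub> reidx subsets_star p \<beta>)
        = exists_along subsets_star p \<alpha> \<sqinter>\<^bsub>fib subsets_star C\<^esub> \<beta>"
      using \<alpha> \<beta> exists_along_subsets_star[OF p] by (auto simp: p0)
  qed
qed

section \<open>The quotient of a doctrine by a filter\<close>

context primary_doctrine
begin

lemma lower_semilattice_fib:
  assumes "X \<in> Obj (base P)"
  shows "weak_partial_order (fib P X)" "partial_order (fib P X)" "weak_lower_semilattice (fib P X)"
    "weak_partial_order_top (fib P X)"
proof -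
  interpret lower_semilattice "fib P X"
    using assms by (rule fib_meets)
  show "weak_partial_order (fib P X)" "partial_order (fib P X)" "weak_lower_semilattice (fib P X)"
    by unfold_locales
  show "weak_partial_order_top (fib P X)"
    using assms by (rule fib_top)
qed

lemmas fib_le_refl = weak_partial_order.le_refl[OF lower_semilattice_fib(1)]
  and fib_le_trans = weak_partial_order.le_trans[OF lower_semilattice_fib(1)]
  and fib_meet_closed = weak_lower_semilattice.meet_closed[OF lower_semilattice_fib(3)]
  and fib_meet_left = weak_lower_semilattice.meet_left[OF lower_semilattice_fib(3)]
  and fib_meet_right = weak_lower_semilattice.meet_right[OF lower_semilattice_fib(3)]
  and fib_meet_le = weak_lower_semilattice.meet_le[OF lower_semilattice_fib(3)]
  and fib_top_closed = weak_partial_order_top.top_closed[OF lower_semilattice_fib(4)]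
  and fib_top_higher = weak_partial_order_top.top_higher[OF lower_semilattice_fib(4)]

lemma fib_meet_comm:
  "\<lbrakk>X \<in> Obj (base P); a \<in> carrier (fib P X); b \<in> carrier (fib P X)\<rbrakk>
    \<Longrightarrow> a \<sqinter>\<^bsub>fib P X\<^esub> b = b \<sqinter>\<^bsub>fib P X\<^esub> a"
  by (simp add: meet_def insert_commute)

lemma fib_le_meet_iff:
  "\<lbrakk>X \<in> Obj (base P); a \<in> carrier (fib P X); b \<in> carrier (fib P X); c \<in> carrier (fib P X)\<rbrakk>
    \<Longrightarrow> a \<sqsubseteq>\<^bsub>fib P X\<^esub> b \<sqinter>\<^bsub>fib P X\<^esub> c \<longleftrightarrow> a \<sqsubseteq>\<^bsub>fib P X\<^esub> b \<and> a \<sqsubseteq>\<^bsub>fib P X\<^esub> c"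
  by (meson fib_le_trans fib_meet_closed fib_meet_left fib_meet_right fib_meet_le)

lemma fib_meet_mono:
  assumes X: "X \<in> Obj (base P)" and cl: "a \<in> carrier (fib P X)" "b \<in> carrier (fib P X)"
      "c \<in> carrier (fib P X)" and "a \<sqsubseteq>\<^bsub>fib P X\<^esub> b"
  shows "a \<sqinter>\<^bsub>fib P X\<^esub> c \<sqsubseteq>\<^bsub>fib P X\<^esub> b \<sqinter>\<^bsub>fib P X\<^esub> c"
proof -
  note ac = fib_meet_closed[OF X cl(1,3)]
  have "a \<sqinter>\<^bsub>fib P X\<^esub> c \<sqsubseteq>\<^bsub>fib P X\<^esub> b"
    by (rule fib_le_trans[OF X fib_meet_left[OF X cl(1,3)] assms(5) ac cl(1,2)])
  then show ?thesis
    using fib_le_meet_iff[OF X ac cl(2,3)] fib_meet_right[OF X cl(1,3)] by blast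
qed

lemma homset_Obj:
  assumes "f \<in> homset (base P) X Y"
  shows "X \<in> Obj (base P)" "Y \<in> Obj (base P)"
proof -
  interpret finite_product_category "base P" by (rule base_category)
  show "X \<in> Obj (base P)" "Y \<in> Obj (base P)"
    using assms Src_Obj Tgt_Obj unfolding homset_def by auto
qed

lemma reidx_in_fib:
  "\<lbrakk>f \<in> homset (base P) X Y; \<alpha> \<in> carrier (fib P Y)\<rbrakk> \<Longrightarrow> reidx P f \<alpha> \<in> carrier (fib P X)"
  using reidx_closed by blast

lemma reidx_le:
  "\<lbrakk>f \<in> homset (base P) X Y; \<alpha> \<in> carrier (fib P Y); \<beta> \<in> carrier (fib P Y); \<alpha> \<sqsubseteq>\<^bsub>fib P Y\<^esub> \<beta>\<rbrakk>
    \<Longrightarrow> reidx P f \<alpha> \<sqsubseteq>\<^bsub>fib P X\<^esub> reidx P f \<beta>"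
  using reidx_mono unfolding isotone_def by blast

end

context implicational_doctrine
begin

lemma heyting_imp_fib:
  assumes "X \<in> Obj (base P)" "\<alpha> \<in> carrier (fib P X)" "\<beta> \<in> carrier (fib P X)"
  shows "is_heyting_imp (fib P X) \<alpha> \<beta> (heyting_imp (fib P X) \<alpha> \<beta>)"
proof -
  obtain \<gamma> where "is_heyting_imp (fib P X) \<alpha> \<beta> \<gamma>"
    using fib_imp[OF assms] ..
  with heyting_imp_eqI[OF lower_semilattice_fib(2)[OF assms(1)] this] show ?thesis
    by simp
qed

lemma heyting_imp_closed:
  "\<lbrakk>X \<in> Obj (base P); \<alpha> \<in> carrier (fib P X); \<beta> \<in> carrier (fib P X)\<rbrakk>
    \<Longrightarrow> heyting_imp (fib P X) \<alpha> \<beta> \<in> carrier (fib P X)"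
  using heyting_imp_fib unfolding is_heyting_imp_def by blast

lemma le_heyting_imp_iff:
  "\<lbrakk>X \<in> Obj (base P); \<alpha> \<in> carrier (fib P X); \<beta> \<in> carrier (fib P X); \<gamma> \<in> carrier (fib P X)\<rbrakk>
    \<Longrightarrow> \<gamma> \<sqsubseteq>\<^bsub>fib P X\<^esub> heyting_imp (fib P X) \<alpha> \<beta> \<longleftrightarrow> \<gamma> \<sqinter>\<^bsub>fib P X\<^esub> \<alpha> \<sqsubseteq>\<^bsub>fib P X\<^esub> \<beta>"
  using heyting_imp_fib unfolding is_heyting_imp_def by blast

end

context existential_doctrine
begin

lemma exists_along_adjoint:
  assumes "product_cone (base P) C B W p q"
  shows "\<alpha> \<in> carrier (fib P W) \<Longrightarrow> exists_along P p \<alpha> \<in> carrier (fib P C)"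
    and "\<lbrakk>\<alpha> \<in> carrier (fib P W); \<beta> \<in> carrier (fib P C)\<rbrakk>
      \<Longrightarrow> exists_along P p \<alpha> \<sqsubseteq>\<^bsub>fib P C\<^esub> \<beta> \<longleftrightarrow> \<alpha> \<sqsubseteq>\<^bsub>fib P W\<^esub> reidx P p \<beta>"
proof -
  have p: "Src (base P) p = W" "Tgt (base P) p = C"
    using assms by (auto simp: product_cone_def homset_def)
  have "left_adjoint_along P p (exists_along P p)"
    unfolding exists_along_def using ex_left_adjoint[OF assms] by (rule someI_ex)
  then interpret galois_connection "\<lparr>orderA = fib P W, orderB = fib P C,
      lower = exists_along P p, upper = reidx P p\<rparr>"
    by (simp add: left_adjoint_along_def p)
  show "\<alpha> \<in> carrier (fib P W) \<Longrightarrow> exists_along P p \<alpha> \<in> carrier (fib P C)"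
    using lower_closed by simp
  show "\<lbrakk>\<alpha> \<in> carrier (fib P W); \<beta> \<in> carrier (fib P C)\<rbrakk>
      \<Longrightarrow> exists_along P p \<alpha> \<sqsubseteq>\<^bsub>fib P C\<^esub> \<beta> \<longleftrightarrow> \<alpha> \<sqsubseteq>\<^bsub>fib P W\<^esub> reidx P p \<beta>"
    using galois_property by simp
qed

end

section \<open>Entailment modulo a filter\<close>

locale filtered_doctrine = primary_doctrine P
  for P :: "('o, 'm, 'p) doctrine" +
  fixes t :: 'o and N :: "'p set"
  assumes terminal: "terminal_object (base P) t"
    and filter: "semilattice_filter (fib P t) N"
begin

abbreviation Q where "Q \<equiv> quotient_doctrine P t N"
abbreviation cls where "cls \<equiv> filter_class P t N"
abbreviation fle where "fle \<equiv> filter_le P t N"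
abbreviation const where "const X \<equiv> reidx P (bang (base P) t X)"

lemma t_Obj: "t \<in> Obj (base P)"
  using terminal unfolding terminal_object_def by blast

lemma ex1_terminal: "X \<in> Obj (base P) \<Longrightarrow> \<exists>!f. f \<in> homset (base P) X t"
  using terminal unfolding terminal_object_def by blast

lemma bang_homset: "X \<in> Obj (base P) \<Longrightarrow> bang (base P) t X \<in> homset (base P) X t"
  unfolding bang_def by (rule theI'[OF ex1_terminal])

lemma eq_bang: "f \<in> homset (base P) X t \<Longrightarrow> bang (base P) t X = f"
  unfolding bang_def by (rule the1_equality[OF ex1_terminal[OF homset_Obj(1)]])

text \<open>Arrows into \<open>t\<close> are unique, so composing \<open>bang\<close> with
  \<open>f\<close> gives \<open>bang\<close> again. Consequently one element of the filter can
  witness an entailment in every fibre reached by reindexing.\<close>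

lemma reidx_const:
  assumes "f \<in> homset (base P) X Y" "\<theta> \<in> carrier (fib P t)"
  shows "reidx P f (const Y \<theta>) = const X \<theta>"
proof -
  interpret category "base P"
    using base_category finite_product_category.axioms(1) by blast
  have b: "bang (base P) t Y \<in> homset (base P) Y t"
    by (rule bang_homset) (rule homset_Obj(2)[OF assms(1)])
  have "bang (base P) t Y \<odot>\<^bsub>base P\<^esub> f = bang (base P) t X"
    by (rule eq_bang[symmetric]) (rule Cmp_homset[OF assms(1) b])
  then show ?thesis
    using reidx_Cmp[OF assms(1) b assms(2)] by simp
qed

text \<open>The identity is the only endoarrow of \<open>t\<close>; over \<open>t\<close>, the
  witness of an entailment is therefore used unchanged and can be met with other members of the
  filter.\<close>

lemma const_t: "\<theta> \<in> carrier (fib P t) \<Longrightarrow> const t \<theta> = \<theta>"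
proof -
  interpret category "base P"
    using base_category finite_product_category.axioms(1) by blast
  assume "\<theta> \<in> carrier (fib P t)"
  then show ?thesis
    using eq_bang[OF Idt_homset[OF t_Obj]] reidx_Idt[OF t_Obj] by metis
qed

lemma filter_mem_fib: "\<theta> \<in> N \<Longrightarrow> \<theta> \<in> carrier (fib P t)"
  and filter_top: "\<top>\<^bsub>fib P t\<^esub> \<in> N"
  and filter_up: "\<lbrakk>\<theta> \<in> N; a \<in> carrier (fib P t); \<theta> \<sqsubseteq>\<^bsub>fib P t\<^esub> a\<rbrakk> \<Longrightarrow> a \<in> N"
  and filter_meet: "\<lbrakk>\<theta> \<in> N; \<theta>' \<in> N\<rbrakk> \<Longrightarrow> \<theta> \<sqinter>\<^bsub>fib P t\<^esub> \<theta>' \<in> N"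
  using filter unfolding semilattice_filter_def by blast+

lemma const_closed: "\<lbrakk>X \<in> Obj (base P); \<theta> \<in> N\<rbrakk> \<Longrightarrow> const X \<theta> \<in> carrier (fib P X)"
  using bang_homset filter_mem_fib reidx_in_fib by blast

lemma filter_leI:
  assumes X: "X \<in> Obj (base P)" "\<alpha> \<in> carrier (fib P X)" "\<beta> \<in> carrier (fib P X)"
    and "\<alpha> \<sqsubseteq>\<^bsub>fib P X\<^esub> \<beta>"
  shows "fle X \<alpha> \<beta>"
  unfolding filter_le_def
proof
  have c: "const X \<top>\<^bsub>fib P t\<^esub> \<in> carrier (fib P X)"
    using X filter_top by (intro const_closed)
  show "const X \<top>\<^bsub>fib P t\<^esub> \<sqinter>\<^bsub>fib P X\<^esub> \<alpha> \<sqsubseteq>\<^bsub>fib P X\<^esub> \<beta>"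
    using fib_le_trans[OF X(1) fib_meet_right[OF X(1) c X(2)] assms(4)]
      fib_meet_closed[OF X(1) c X(2)] X by blast
qed (rule filter_top)

lemma filter_le_refl: "\<lbrakk>X \<in> Obj (base P); \<alpha> \<in> carrier (fib P X)\<rbrakk> \<Longrightarrow> fle X \<alpha> \<alpha>"
  by (intro filter_leI fib_le_refl)

text \<open>Closure of the filter under binary meets merges two witnesses into one. Transitivity and
  the universal property of meets both depend on having a single \<open>\<theta>\<close> for two
  entailments.\<close>

lemma filter_le_common:
  assumes X: "X \<in> Obj (base P)" "\<alpha> \<in> carrier (fib P X)" "\<beta> \<in> carrier (fib P X)"
      "\<gamma> \<in> carrier (fib P X)" "\<delta> \<in> carrier (fib P X)"
    and "fle X \<alpha> \<beta>" "fle X \<gamma> \<delta>"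
  obtains \<theta> where "\<theta> \<in> N" "const X \<theta> \<sqinter>\<^bsub>fib P X\<^esub> \<alpha> \<sqsubseteq>\<^bsub>fib P X\<^esub> \<beta>"
    "const X \<theta> \<sqinter>\<^bsub>fib P X\<^esub> \<gamma> \<sqsubseteq>\<^bsub>fib P X\<^esub> \<delta>"
proof -
  obtain \<theta> \<eta> where
    \<theta>: "\<theta> \<in> N" "const X \<theta> \<sqinter>\<^bsub>fib P X\<^esub> \<alpha> \<sqsubseteq>\<^bsub>fib P X\<^esub> \<beta>" and
    \<eta>: "\<eta> \<in> N" "const X \<eta> \<sqinter>\<^bsub>fib P X\<^esub> \<gamma> \<sqsubseteq>\<^bsub>fib P X\<^esub> \<delta>"
    using assms(6,7) unfolding filter_le_def by blast
  let ?\<zeta> = "\<theta> \<sqinter>\<^bsub>fib P t\<^esub> \<eta>"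
  have eq: "const X ?\<zeta> = const X \<theta> \<sqinter>\<^bsub>fib P X\<^esub> const X \<eta>"
    using reidx_meet[OF bang_homset[OF X(1)]] \<theta> \<eta> filter_mem_fib by blast
  note cl = const_closed[OF X(1) \<theta>(1)] const_closed[OF X(1) \<eta>(1)]
  have c: "const X ?\<zeta> \<in> carrier (fib P X)"
    using \<theta> \<eta> by (intro const_closed[OF X(1)] filter_meet)
  \<comment> \<open>A smaller constant is still a witness: each entailment survives when its own
    constant is replaced by the meet of both.\<close>
  have le: "const X ?\<zeta> \<sqinter>\<^bsub>fib P X\<^esub> \<xi> \<sqsubseteq>\<^bsub>fib P X\<^esub> \<xi>'"
    if cl': "\<kappa> \<in> carrier (fib P X)" "\<xi> \<in> carrier (fib P X)" "\<xi>' \<in> carrier (fib P X)"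
      and "const X ?\<zeta> \<sqsubseteq>\<^bsub>fib P X\<^esub> \<kappa>" "\<kappa> \<sqinter>\<^bsub>fib P X\<^esub> \<xi> \<sqsubseteq>\<^bsub>fib P X\<^esub> \<xi>'" for \<kappa> \<xi> \<xi>'
    by (rule fib_le_trans[OF X(1) fib_meet_mono[OF X(1) c cl'(1,2)] _
        fib_meet_closed[OF X(1) c cl'(2)] fib_meet_closed[OF X(1) cl'(1,2)] cl'(3)])
      (fact that)+
  show ?thesis
  proof (rule that[OF filter_meet[OF \<theta>(1) \<eta>(1)]])
    show "const X ?\<zeta> \<sqinter>\<^bsub>fib P X\<^esub> \<alpha> \<sqsubseteq>\<^bsub>fib P X\<^esub> \<beta>"
      by (rule le[OF cl(1) X(2,3) _ \<theta>(2)]) (simp add: eq fib_meet_left X(1) cl)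
    show "const X ?\<zeta> \<sqinter>\<^bsub>fib P X\<^esub> \<gamma> \<sqsubseteq>\<^bsub>fib P X\<^esub> \<delta>"
      by (rule le[OF cl(2) X(4,5) _ \<eta>(2)]) (simp add: eq fib_meet_right X(1) cl)
  qed
qed

lemma filter_le_trans:
  assumes X: "X \<in> Obj (base P)" "\<alpha> \<in> carrier (fib P X)" "\<beta> \<in> carrier (fib P X)"
      "\<gamma> \<in> carrier (fib P X)"
    and "fle X \<alpha> \<beta>" "fle X \<beta> \<gamma>"
  shows "fle X \<alpha> \<gamma>"
proof -
  obtain \<theta> where \<theta>: "\<theta> \<in> N" "const X \<theta> \<sqinter>\<^bsub>fib P X\<^esub> \<alpha> \<sqsubseteq>\<^bsub>fib P X\<^esub> \<beta>"
      "const X \<theta> \<sqinter>\<^bsub>fib P X\<^esub> \<beta> \<sqsubseteq>\<^bsub>fib P X\<^esub> \<gamma>"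
    using filter_le_common[OF X(1,2,3,3,4) assms(5,6)] by blast
  note c = const_closed[OF X(1) \<theta>(1)]
  \<comment> \<open>The constant is retained on the right, since the second entailment needs it
    again.\<close>
  have "const X \<theta> \<sqinter>\<^bsub>fib P X\<^esub> \<alpha> \<sqsubseteq>\<^bsub>fib P X\<^esub> const X \<theta> \<sqinter>\<^bsub>fib P X\<^esub> \<beta>"
    using fib_le_meet_iff[OF X(1) fib_meet_closed[OF X(1) c X(2)] c X(3)]
      fib_meet_left[OF X(1) c X(2)] \<theta> by blast
  then have "const X \<theta> \<sqinter>\<^bsub>fib P X\<^esub> \<alpha> \<sqsubseteq>\<^bsub>fib P X\<^esub> \<gamma>"
    by (rule fib_le_trans[OF X(1) _ \<theta>(3) fib_meet_closed[OF X(1) c X(2)]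
        fib_meet_closed[OF X(1) c X(3)] X(4)])
  with \<theta> show ?thesis
    unfolding filter_le_def by blast
qed

lemma filter_le_meet_iff:
  assumes X: "X \<in> Obj (base P)" "\<alpha> \<in> carrier (fib P X)" "\<beta> \<in> carrier (fib P X)"
      "\<gamma> \<in> carrier (fib P X)"
  shows "fle X \<gamma> (\<alpha> \<sqinter>\<^bsub>fib P X\<^esub> \<beta>) \<longleftrightarrow> fle X \<gamma> \<alpha> \<and> fle X \<gamma> \<beta>"
proof safe
  note m = fib_meet_closed[OF X(1,2,3)]
  assume "fle X \<gamma> (\<alpha> \<sqinter>\<^bsub>fib P X\<^esub> \<beta>)"
  then show "fle X \<gamma> \<alpha>" "fle X \<gamma> \<beta>"
    using filter_le_trans[OF X(1,4) m X(2)] filter_leI[OF X(1) m X(2) fib_meet_left[OF X(1,2,3)]]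
      filter_le_trans[OF X(1,4) m X(3)] filter_leI[OF X(1) m X(3) fib_meet_right[OF X(1,2,3)]]
    by blast+
next
  assume "fle X \<gamma> \<alpha>" "fle X \<gamma> \<beta>"
  then obtain \<theta> where \<theta>: "\<theta> \<in> N" "const X \<theta> \<sqinter>\<^bsub>fib P X\<^esub> \<gamma> \<sqsubseteq>\<^bsub>fib P X\<^esub> \<alpha>"
      "const X \<theta> \<sqinter>\<^bsub>fib P X\<^esub> \<gamma> \<sqsubseteq>\<^bsub>fib P X\<^esub> \<beta>"
    using filter_le_common[OF X(1,4,2,4,3)] by blast
  then show "fle X \<gamma> (\<alpha> \<sqinter>\<^bsub>fib P X\<^esub> \<beta>)"
    unfolding filter_le_def
    using fib_le_meet_iff[OF X(1) fib_meet_closed[OF X(1) const_closed[OF X(1) \<theta>(1)] X(4)] X(2,3)]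
    by blast
qed

text \<open>The same \<open>\<theta>\<close> works after reindexing, which preserves meets and
  carries constants to constants.\<close>

lemma filter_le_reidx:
  assumes f: "f \<in> homset (base P) X Y"
    and Y: "\<alpha> \<in> carrier (fib P Y)" "\<beta> \<in> carrier (fib P Y)" and "fle Y \<alpha> \<beta>"
  shows "fle X (reidx P f \<alpha>) (reidx P f \<beta>)"
proof -
  obtain \<theta> where \<theta>: "\<theta> \<in> N" "const Y \<theta> \<sqinter>\<^bsub>fib P Y\<^esub> \<alpha> \<sqsubseteq>\<^bsub>fib P Y\<^esub> \<beta>"
    using assms(4) unfolding filter_le_def by blast
  note c = const_closed[OF homset_Obj(2)[OF f] \<theta>(1)]
  have "reidx P f (const Y \<theta> \<sqinter>\<^bsub>fib P Y\<^esub> \<alpha>) \<sqsubseteq>\<^bsub>fib P X\<^esub> reidx P f \<beta>"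
    using reidx_le[OF f] fib_meet_closed[OF homset_Obj(2)[OF f]] c Y \<theta> by blast
  then have "const X \<theta> \<sqinter>\<^bsub>fib P X\<^esub> reidx P f \<alpha> \<sqsubseteq>\<^bsub>fib P X\<^esub> reidx P f \<beta>"
    using reidx_meet[OF f c Y(1)] reidx_const[OF f filter_mem_fib[OF \<theta>(1)]] by simp
  with \<theta> show ?thesis
    unfolding filter_le_def by blast
qed

text \<open>Over \<open>t\<close> the witness is itself a member of \<open>N\<close>, so its meet
  with \<open>\<alpha>\<close> belongs to \<open>N\<close> and lies below \<open>\<beta>\<close>.
  This is the bridge from entailment modulo the filter to truth at a point.\<close>

lemma filter_le_t_mem:
  assumes "\<alpha> \<in> N" "\<beta> \<in> carrier (fib P t)" "fle t \<alpha> \<beta>"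
  shows "\<beta> \<in> N"
proof -
  obtain \<theta> where \<theta>: "\<theta> \<in> N" "const t \<theta> \<sqinter>\<^bsub>fib P t\<^esub> \<alpha> \<sqsubseteq>\<^bsub>fib P t\<^esub> \<beta>"
    using assms(3) unfolding filter_le_def by blast
  then show ?thesis
    using filter_up[OF filter_meet[OF \<theta>(1) assms(1)] assms(2)] const_t[OF filter_mem_fib[OF \<theta>(1)]]
    by simp
qed

section \<open>Classes of formulas and the quotient order\<close>

lemma equiv_filter_eq:
  assumes X: "X \<in> Obj (base P)"
  shows "equiv (carrier (fib P X)) (filter_eq P t N X)"
proof (rule equivI)
  show "filter_eq P t N X \<subseteq> carrier (fib P X) \<times> carrier (fib P X)"
    by (auto simp: filter_eq_def)
  show "refl_on (carrier (fib P X)) (filter_eq P t N X)"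
    using filter_le_refl[OF X] by (auto simp: refl_on_def filter_eq_def)
  show "sym (filter_eq P t N X)"
    by (auto simp: sym_def filter_eq_def)
  show "trans (filter_eq P t N X)"
    unfolding trans_def filter_eq_def using filter_le_trans[OF X] by blast
qed

lemma mem_cls_iff:
  "\<phi> \<in> cls X \<alpha> \<longleftrightarrow> \<alpha> \<in> carrier (fib P X) \<and> \<phi> \<in> carrier (fib P X) \<and> fle X \<alpha> \<phi> \<and> fle X \<phi> \<alpha>"
  by (auto simp: filter_class_def filter_eq_def)

lemma cls_self: "\<lbrakk>X \<in> Obj (base P); \<alpha> \<in> carrier (fib P X)\<rbrakk> \<Longrightarrow> \<alpha> \<in> cls X \<alpha>"
  by (simp add: mem_cls_iff filter_le_refl)

lemma cls_eq_iff:
  "\<lbrakk>X \<in> Obj (base P); \<alpha> \<in> carrier (fib P X); \<beta> \<in> carrier (fib P X)\<rbrakk>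
    \<Longrightarrow> cls X \<alpha> = cls X \<beta> \<longleftrightarrow> fle X \<alpha> \<beta> \<and> fle X \<beta> \<alpha>"
  using eq_equiv_class_iff[OF equiv_filter_eq, of X \<alpha> \<beta>]
  by (simp add: filter_class_def) (simp add: filter_eq_def)

lemma Q_simps [simp]: "base Q = base P" "eq (fib Q X) = (=)"
  by (simp_all add: quotient_doctrine_def)

lemma Q_carrier: "carrier (fib Q X) = cls X ` carrier (fib P X)"
  by (simp add: quotient_doctrine_def quotient_def filter_class_def UNION_singleton_eq_range)

lemma Q_carrierE:
  assumes "a \<in> carrier (fib Q X)"
  obtains \<alpha> where "\<alpha> \<in> carrier (fib P X)" "a = cls X \<alpha>"
  using assms by (auto simp: Q_carrier)

lemma cls_closed: "\<alpha> \<in> carrier (fib P X) \<Longrightarrow> cls X \<alpha> \<in> carrier (fib Q X)"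
  by (simp add: Q_carrier)

text \<open>The quotient order only asks for some pair of related representatives; transitivity
  carries the relation to the given ones.\<close>

lemma cls_le_iff:
  assumes "X \<in> Obj (base P)" "\<alpha> \<in> carrier (fib P X)" "\<beta> \<in> carrier (fib P X)"
  shows "cls X \<alpha> \<sqsubseteq>\<^bsub>fib Q X\<^esub> cls X \<beta> \<longleftrightarrow> fle X \<alpha> \<beta>"
proof
  assume "cls X \<alpha> \<sqsubseteq>\<^bsub>fib Q X\<^esub> cls X \<beta>"
  then obtain \<phi> \<psi> where "\<phi> \<in> cls X \<alpha>" "\<psi> \<in> cls X \<beta>" and le: "fle X \<phi> \<psi>"
    by (auto simp: quotient_doctrine_def)
  then have cl: "\<phi> \<in> carrier (fib P X)" "\<psi> \<in> carrier (fib P X)"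
    and le': "fle X \<alpha> \<phi>" "fle X \<psi> \<beta>"
    by (auto simp: mem_cls_iff)
  show "fle X \<alpha> \<beta>"
    using filter_le_trans[OF assms(1,2) cl(1) assms(3) le'(1)]
      filter_le_trans[OF assms(1) cl assms(3) le le'(2)] by blast
next
  assume "fle X \<alpha> \<beta>"
  then show "cls X \<alpha> \<sqsubseteq>\<^bsub>fib Q X\<^esub> cls X \<beta>"
    using cls_self assms by (auto simp: quotient_doctrine_def)
qed

text \<open>The union defining reindexing runs over a constant family: entailment is stable under
  reindexing, so all representatives contribute the same class. The index set is non-empty because
  it contains \<open>\<alpha>\<close>.\<close>

lemma reidx_cls:
  assumes f: "f \<in> homset (base P) X Y" and \<alpha>: "\<alpha> \<in> carrier (fib P Y)"
  shows "reidx Q f (cls Y \<alpha>) = cls X (reidx P f \<alpha>)"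
proof -
  have "cls X (reidx P f \<phi>) = cls X (reidx P f \<alpha>)" if "\<phi> \<in> cls Y \<alpha>" for \<phi>
    using that cls_eq_iff[OF homset_Obj(1)[OF f]] reidx_in_fib[OF f] filter_le_reidx[OF f]
    by (simp add: mem_cls_iff)
  moreover have "cls Y \<alpha> \<noteq> {}"
    using cls_self[OF homset_Obj(2)[OF f] \<alpha>] by blast
  moreover have "Src (base P) f = X"
    using f by (simp add: homset_def)
  ultimately show ?thesis
    by (simp add: quotient_doctrine_def)
qed

lemma partial_order_Q:
  assumes X: "X \<in> Obj (base P)"
  shows "partial_order (fib Q X)"
proof
  fix a b c assume "a \<in> carrier (fib Q X)" "b \<in> carrier (fib Q X)" "c \<in> carrier (fib Q X)"
    "a \<sqsubseteq>\<^bsub>fib Q X\<^esub> b" "b \<sqsubseteq>\<^bsub>fib Q X\<^esub> c"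
  then show "a \<sqsubseteq>\<^bsub>fib Q X\<^esub> c"
    using X by (auto elim!: Q_carrierE simp: cls_le_iff intro: filter_le_trans)
next
  fix a b assume "a \<in> carrier (fib Q X)" "b \<in> carrier (fib Q X)" "a \<sqsubseteq>\<^bsub>fib Q X\<^esub> b" "b \<sqsubseteq>\<^bsub>fib Q X\<^esub> a"
  then show "a .=\<^bsub>fib Q X\<^esub> b"
    by (elim Q_carrierE) (simp add: X cls_le_iff cls_eq_iff)
qed (use X in \<open>auto elim!: Q_carrierE simp: cls_le_iff filter_le_refl\<close>)

text \<open>Packaged for two uses: these facts compute the meet of two classes and also show that
  greatest lower bounds exist.\<close>

lemma meet_cls_props:
  assumes X: "X \<in> Obj (base P)" and \<alpha>\<beta>: "\<alpha> \<in> carrier (fib P X)" "\<beta> \<in> carrier (fib P X)"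
  defines "m \<equiv> cls X (\<alpha> \<sqinter>\<^bsub>fib P X\<^esub> \<beta>)"
  shows "m \<in> carrier (fib Q X)" "m \<sqsubseteq>\<^bsub>fib Q X\<^esub> cls X \<alpha>" "m \<sqsubseteq>\<^bsub>fib Q X\<^esub> cls X \<beta>"
    and "\<lbrakk>w \<in> carrier (fib Q X); w \<sqsubseteq>\<^bsub>fib Q X\<^esub> cls X \<alpha>; w \<sqsubseteq>\<^bsub>fib Q X\<^esub> cls X \<beta>\<rbrakk>
      \<Longrightarrow> w \<sqsubseteq>\<^bsub>fib Q X\<^esub> m"
  using assms fib_meet_closed[OF X \<alpha>\<beta>] filter_leI[OF X] fib_meet_left[OF X \<alpha>\<beta>]
    fib_meet_right[OF X \<alpha>\<beta>]
  by (auto elim!: Q_carrierE simp: cls_closed cls_le_iff filter_le_meet_iff)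

lemma meet_cls:
  assumes "X \<in> Obj (base P)" "\<alpha> \<in> carrier (fib P X)" "\<beta> \<in> carrier (fib P X)"
  shows "cls X \<alpha> \<sqinter>\<^bsub>fib Q X\<^esub> cls X \<beta> = cls X (\<alpha> \<sqinter>\<^bsub>fib P X\<^esub> \<beta>)"
  using assms by (intro partial_order.meet_eqI[OF partial_order_Q] meet_cls_props cls_closed)

lemma lower_semilattice_Q:
  assumes X: "X \<in> Obj (base P)"
  shows "lower_semilattice (fib Q X)"
proof -
  interpret partial_order "fib Q X"
    using X by (rule partial_order_Q)
  show ?thesis
  proof
    fix a b assume "a \<in> carrier (fib Q X)" "b \<in> carrier (fib Q X)"
    then obtain \<alpha> \<beta> where ab: "\<alpha> \<in> carrier (fib P X)" "\<beta> \<in> carrier (fib P X)"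
        "a = cls X \<alpha>" "b = cls X \<beta>"
      by (auto elim!: Q_carrierE)
    have "greatest (fib Q X) (cls X (\<alpha> \<sqinter>\<^bsub>fib P X\<^esub> \<beta>)) (Lower (fib Q X) {a, b})"
      unfolding ab(3,4) using X ab(1,2)
      by (intro greatest_Lower_pairI meet_cls_props cls_closed)
    then show "\<exists>s. greatest (fib Q X) s (Lower (fib Q X) {a, b})" ..
  qed
qed

lemma cls_top_greatest:
  assumes X: "X \<in> Obj (base P)" and "a \<in> carrier (fib Q X)"
  shows "a \<sqsubseteq>\<^bsub>fib Q X\<^esub> cls X \<top>\<^bsub>fib P X\<^esub>"
  using assms fib_top_closed[OF X] fib_top_higher[OF X] filter_leI[OF X]
  by (auto elim!: Q_carrierE simp: cls_le_iff)

lemma top_Q: "X \<in> Obj (base P) \<Longrightarrow> \<top>\<^bsub>fib Q X\<^esub> = cls X \<top>\<^bsub>fib P X\<^esub>"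
  by (intro partial_order.top_eqI[OF partial_order_Q] cls_closed fib_top_closed cls_top_greatest)

lemma weak_partial_order_top_Q:
  assumes X: "X \<in> Obj (base P)"
  shows "weak_partial_order_top (fib Q X)"
proof -
  interpret partial_order "fib Q X"
    using X by (rule partial_order_Q)
  have "greatest (fib Q X) (cls X \<top>\<^bsub>fib P X\<^esub>) (carrier (fib Q X))"
    using X by (simp add: greatest_def cls_closed fib_top_closed cls_top_greatest)
  then show ?thesis
    by unfold_locales blast
qed

section \<open>Propositional structure of the quotient doctrine\<close>

lemma doctrine_Q: "doctrine Q"
proof (rule doctrine.intro, unfold Q_simps)
  interpret finite_product_category "base P" by (rule base_category)
  show "finite_product_category (base P)" by (rule base_category)
  show "partial_order (fib Q X)" if "X \<in> Obj (base P)" for X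
    using that by (rule partial_order_Q)
  show "reidx Q (Idt (base P) X) a = a"
    if "X \<in> Obj (base P)" "a \<in> carrier (fib Q X)" for X a
    using that by (auto elim!: Q_carrierE simp: reidx_cls[OF Idt_homset] reidx_Idt)
  show "reidx Q (g \<odot>\<^bsub>base P\<^esub> f) a = reidx Q f (reidx Q g a)"
    if "f \<in> homset (base P) X Y" "g \<in> homset (base P) Y Z" "a \<in> carrier (fib Q Z)" for f g X Y Z a
    using that Cmp_homset[OF that(1,2)] reidx_in_fib[OF that(2)]
    by (auto elim!: Q_carrierE simp: reidx_cls reidx_Cmp)
next
  fix f X Y assume f: "f \<in> homset (base P) X Y"
  show "reidx Q f \<in> carrier (fib Q Y) \<rightarrow> carrier (fib Q X)"
    using reidx_in_fib[OF f] by (auto elim!: Q_carrierE simp: reidx_cls[OF f] cls_closed)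
  show "isotone (fib Q Y) (fib Q X) (reidx Q f)"
  proof (rule isotoneI)
    show "weak_partial_order (fib Q Y)" "weak_partial_order (fib Q X)"
      using homset_Obj[OF f] partial_order_Q partial_order.axioms(1) by blast+
    show "reidx Q f a \<sqsubseteq>\<^bsub>fib Q X\<^esub> reidx Q f b"
      if "a \<in> carrier (fib Q Y)" "b \<in> carrier (fib Q Y)" "a \<sqsubseteq>\<^bsub>fib Q Y\<^esub> b" for a b
      using that homset_Obj[OF f] reidx_in_fib[OF f] filter_le_reidx[OF f]
      by (auto elim!: Q_carrierE simp: reidx_cls[OF f] cls_le_iff)
  qed
qed

lemma primary_Q: "primary_doctrine Q"
proof (intro primary_doctrine.intro primary_doctrine_axioms.intro doctrine_Q, unfold Q_simps)
  show "lower_semilattice (fib Q X)" "weak_partial_order_top (fib Q X)"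
    if "X \<in> Obj (base P)" for X
    using that by (rule lower_semilattice_Q weak_partial_order_top_Q)+
  show "reidx Q f \<top>\<^bsub>fib Q Y\<^esub> = \<top>\<^bsub>fib Q X\<^esub>" if "f \<in> homset (base P) X Y" for f X Y
    using that homset_Obj[OF that] by (simp add: top_Q reidx_cls fib_top_closed reidx_top)
  show "reidx Q f (a \<sqinter>\<^bsub>fib Q Y\<^esub> b) = reidx Q f a \<sqinter>\<^bsub>fib Q X\<^esub> reidx Q f b"
    if "f \<in> homset (base P) X Y" "a \<in> carrier (fib Q Y)" "b \<in> carrier (fib Q Y)" for f X Y a b
    using that homset_Obj[OF that(1)] reidx_in_fib[OF that(1)]
    by (auto elim!: Q_carrierE simp: meet_cls reidx_cls fib_meet_closed reidx_meet)
qed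

lemma bottom_Q:
  assumes "bounded_doctrine P" and X: "X \<in> Obj (base P)"
  shows "least (fib Q X) (cls X \<bottom>\<^bsub>fib P X\<^esub>) (carrier (fib Q X))"
    and "\<bottom>\<^bsub>fib Q X\<^esub> = cls X \<bottom>\<^bsub>fib P X\<^esub>"
proof -
  interpret weak_partial_order_bottom "fib P X"
    using assms by (rule bounded_doctrine.fib_bottom)
  have *: "cls X \<bottom>\<^bsub>fib P X\<^esub> \<sqsubseteq>\<^bsub>fib Q X\<^esub> a" if "a \<in> carrier (fib Q X)" for a
    using that X filter_leI[OF X bottom_closed] bottom_lower
    by (elim Q_carrierE) (simp add: cls_le_iff)
  then show "least (fib Q X) (cls X \<bottom>\<^bsub>fib P X\<^esub>) (carrier (fib Q X))"
    by (simp add: least_def cls_closed)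
  show "\<bottom>\<^bsub>fib Q X\<^esub> = cls X \<bottom>\<^bsub>fib P X\<^esub>"
    using X * by (intro partial_order.bottom_eqI[OF partial_order_Q] cls_closed) auto
qed

lemma bounded_Q:
  assumes "bounded_doctrine P"
  shows "bounded_doctrine Q"
proof (intro bounded_doctrine.intro bounded_doctrine_axioms.intro doctrine_Q, unfold Q_simps)
  interpret P: bounded_doctrine P by fact
  interpret Q: primary_doctrine Q by (rule primary_Q)
  show "weak_partial_order_top (fib Q X)" if "X \<in> Obj (base P)" for X
    using that by (rule weak_partial_order_top_Q)
  show "weak_partial_order_bottom (fib Q X)" if X: "X \<in> Obj (base P)" for X
  proof -
    interpret partial_order "fib Q X"
      using X by (rule partial_order_Q)
    show ?thesis
      using bottom_Q(1)[OF assms X] by unfold_locales blast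
  qed
  show "reidx Q f \<top>\<^bsub>fib Q Y\<^esub> = \<top>\<^bsub>fib Q X\<^esub>" if "f \<in> homset (base P) X Y" for f X Y
    using Q.reidx_top that by simp
  show "reidx Q f \<bottom>\<^bsub>fib Q Y\<^esub> = \<bottom>\<^bsub>fib Q X\<^esub>" if f: "f \<in> homset (base P) X Y" for f X Y
  proof -
    have "\<bottom>\<^bsub>fib P Y\<^esub> \<in> carrier (fib P Y)"
      using P.fib_bottom[OF homset_Obj(2)[OF f]] weak_partial_order_bottom.bottom_closed by blast
    then show ?thesis
      using f homset_Obj[OF f] by (simp add: bottom_Q(2)[OF assms] reidx_cls P.reidx_bottom)
  qed
qed

text \<open>The adjunction already holds for each witness \<open>\<theta>\<close> separately, by
  associativity of meets; the same \<open>\<theta>\<close> serves on both sides, so the existential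
  quantifier over witnesses passes through the equivalence.\<close>

lemma is_heyting_imp_Q:
  assumes "implicational_doctrine P"
    and X: "X \<in> Obj (base P)" "\<alpha> \<in> carrier (fib P X)" "\<beta> \<in> carrier (fib P X)"
  shows "is_heyting_imp (fib Q X) (cls X \<alpha>) (cls X \<beta>) (cls X (heyting_imp (fib P X) \<alpha> \<beta>))"
proof -
  interpret P: implicational_doctrine P by fact
  note imp_closed = P.heyting_imp_closed[OF X]
  have "fle X \<gamma> (heyting_imp (fib P X) \<alpha> \<beta>) \<longleftrightarrow> fle X (\<gamma> \<sqinter>\<^bsub>fib P X\<^esub> \<alpha>) \<beta>"
    if \<gamma>: "\<gamma> \<in> carrier (fib P X)" for \<gamma>
  proof -
    have "const X \<theta> \<sqinter>\<^bsub>fib P X\<^esub> \<gamma> \<sqsubseteq>\<^bsub>fib P X\<^esub> heyting_imp (fib P X) \<alpha> \<beta> \<longleftrightarrow>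
        const X \<theta> \<sqinter>\<^bsub>fib P X\<^esub> (\<gamma> \<sqinter>\<^bsub>fib P X\<^esub> \<alpha>) \<sqsubseteq>\<^bsub>fib P X\<^esub> \<beta>" if "\<theta> \<in> N" for \<theta>
    proof -
      note c = const_closed[OF X(1) that]
      interpret lower_semilattice "fib P X"
        using X(1) by (rule fib_meets)
      show ?thesis
        using P.le_heyting_imp_iff[OF X] c \<gamma> X meet_assoc[OF c \<gamma> X(2)] by simp
    qed
    then show ?thesis
      unfolding filter_le_def by blast
  qed
  then show ?thesis
    using X imp_closed fib_meet_closed[OF X(1)]
    by (auto simp: is_heyting_imp_def cls_closed meet_cls cls_le_iff elim!: Q_carrierE)
qed

lemma heyting_imp_cls:
  assumes "implicational_doctrine P"
    and "X \<in> Obj (base P)" "\<alpha> \<in> carrier (fib P X)" "\<beta> \<in> carrier (fib P X)"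
  shows "heyting_imp (fib Q X) (cls X \<alpha>) (cls X \<beta>) = cls X (heyting_imp (fib P X) \<alpha> \<beta>)"
  using assms by (intro heyting_imp_eqI partial_order_Q is_heyting_imp_Q)

lemma implicational_Q:
  assumes "implicational_doctrine P"
  shows "implicational_doctrine Q"
proof (intro implicational_doctrine.intro implicational_doctrine_axioms.intro primary_Q,
    unfold Q_simps)
  interpret P: implicational_doctrine P by fact
  show "\<exists>c. is_heyting_imp (fib Q X) a b c"
    if "X \<in> Obj (base P)" "a \<in> carrier (fib Q X)" "b \<in> carrier (fib Q X)" for X a b
    using that is_heyting_imp_Q[OF assms] by (fastforce elim!: Q_carrierE)
  show "reidx Q f (heyting_imp (fib Q Y) a b)
      = heyting_imp (fib Q X) (reidx Q f a) (reidx Q f b)"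
    if f: "f \<in> homset (base P) X Y" and "a \<in> carrier (fib Q Y)" "b \<in> carrier (fib Q Y)"
    for f X Y a b
    using that homset_Obj[OF f] reidx_in_fib[OF f]
    by (auto elim!: Q_carrierE
        simp: heyting_imp_cls[OF assms] reidx_cls P.heyting_imp_closed P.reidx_imp)
qed

end

section \<open>Quantifiers of the quotient doctrine\<close>

locale filtered_existential_doctrine = filtered_doctrine + existential_doctrine
begin

text \<open>Frobenius lets the constant \<open>\<theta>\<close> witnessing an entailment pass through the quantifier, so
  the adjunction survives modulo the filter.\<close>

lemma filter_le_exists_iff:
  assumes cone: "product_cone (base P) C B W p q"
    and \<alpha>: "\<alpha> \<in> carrier (fib P W)" and \<beta>: "\<beta> \<in> carrier (fib P C)"
  shows "fle C (exists_along P p \<alpha>) \<beta> \<longleftrightarrow> fle W \<alpha> (reidx P p \<beta>)"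
proof -
  have p: "p \<in> homset (base P) W C" and Obj: "W \<in> Obj (base P)" "C \<in> Obj (base P)"
    using cone by (auto simp: product_cone_def)
  note ex = exists_along_adjoint[OF cone]
  have "const C \<theta> \<sqinter>\<^bsub>fib P C\<^esub> exists_along P p \<alpha> \<sqsubseteq>\<^bsub>fib P C\<^esub> \<beta> \<longleftrightarrow>
      const W \<theta> \<sqinter>\<^bsub>fib P W\<^esub> \<alpha> \<sqsubseteq>\<^bsub>fib P W\<^esub> reidx P p \<beta>" if "\<theta> \<in> N" for \<theta>
  proof -
    note c = const_closed[OF Obj(1) that] const_closed[OF Obj(2) that]
    have "const C \<theta> \<sqinter>\<^bsub>fib P C\<^esub> exists_along P p \<alpha>
        = exists_along P p (const W \<theta> \<sqinter>\<^bsub>fib P W\<^esub> \<alpha>)"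
      using Frobenius[OF cone \<alpha> c(2)] reidx_const[OF p filter_mem_fib[OF that]]
        fib_meet_comm[OF Obj(1) c(1) \<alpha>] fib_meet_comm[OF Obj(2) c(2) ex(1)[OF \<alpha>]] by simp
    then show ?thesis
      using ex(2) fib_meet_closed Obj c \<alpha> \<beta> by simp
  qed
  then show ?thesis
    unfolding filter_le_def by blast
qed

text \<open>An adjoint must be a function of the class alone, hence a chosen representative; the
  second part shows that the choice is immaterial and is the form in which the quantifier is
  computed.\<close>

lemma left_adjoint_along_Q:
  assumes cone: "product_cone (base P) C B W p q"
  shows "left_adjoint_along Q p (\<lambda>a. cls C (exists_along P p (SOME \<alpha>. \<alpha> \<in> a)))"
    and "\<alpha> \<in> carrier (fib P W) \<Longrightarrow> exists_along Q p (cls W \<alpha>) = cls C (exists_along P p \<alpha>)"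
proof -
  let ?E = "\<lambda>a. cls C (exists_along P p (SOME \<alpha>. \<alpha> \<in> a))"
  have p: "p \<in> homset (base P) W C" and Obj: "W \<in> Obj (base P)" "C \<in> Obj (base P)"
    using cone by (auto simp: product_cone_def)
  then have st: "Src (base P) p = W" "Tgt (base P) p = C"
    by (auto simp: homset_def)
  note ex = exists_along_adjoint[OF cone]
  \<comment> \<open>Monotonicity modulo the filter comes from the adjunction modulo the filter:
    follow \<open>\<alpha>\<close> entails \<open>\<beta>\<close> by the unit at
    \<open>\<beta>\<close> and transpose. It makes the class of the quantified formula independent
    of the representative.\<close>
  have le: "fle C (exists_along P p \<alpha>) (exists_along P p \<beta>)"
    if "\<alpha> \<in> carrier (fib P W)" "\<beta> \<in> carrier (fib P W)" "fle W \<alpha> \<beta>" for \<alpha> \<beta>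
  proof -
    note r = reidx_in_fib[OF p ex(1)[OF that(2)]]
    have "fle W \<beta> (reidx P p (exists_along P p \<beta>))"
      using filter_le_exists_iff[OF cone that(2) ex(1)[OF that(2)]]
        filter_le_refl[OF Obj(2) ex(1)[OF that(2)]] by blast
    then show ?thesis
      using filter_le_exists_iff[OF cone that(1) ex(1)[OF that(2)]]
        filter_le_trans[OF Obj(1) that(1,2) r that(3)] by blast
  qed
  have E: "?E (cls W \<alpha>) = cls C (exists_along P p \<alpha>)" if \<alpha>: "\<alpha> \<in> carrier (fib P W)" for \<alpha>
  proof -
    define \<phi> where "\<phi> = (SOME \<phi>. \<phi> \<in> cls W \<alpha>)"
    have "\<phi> \<in> cls W \<alpha>"
      unfolding \<phi>_def using cls_self[OF Obj(1) \<alpha>] by (rule someI)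
    then have \<phi>: "\<phi> \<in> carrier (fib P W)" "fle W \<alpha> \<phi>" "fle W \<phi> \<alpha>"
      by (auto simp: mem_cls_iff)
    have "cls C (exists_along P p \<phi>) = cls C (exists_along P p \<alpha>)"
      using cls_eq_iff[OF Obj(2) ex(1)[OF \<phi>(1)] ex(1)[OF \<alpha>]]
        le[OF \<alpha> \<phi>(1,2)] le[OF \<phi>(1) \<alpha> \<phi>(3)] by blast
    then show ?thesis
      unfolding \<phi>_def .
  qed
  show adj: "left_adjoint_along Q p ?E"
    unfolding left_adjoint_along_def Q_simps st
  proof (intro galois_connection.intro connection.intro galois_connection_axioms.intro;
      (unfold galcon.simps)?)
    show "partial_order (fib Q W)" "partial_order (fib Q C)"
      using Obj partial_order_Q by blast+
    show "?E \<in> carrier (fib Q W) \<rightarrow> carrier (fib Q C)"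
      using ex(1) by (auto elim!: Q_carrierE simp: E cls_closed)
    show "reidx Q p \<in> carrier (fib Q C) \<rightarrow> carrier (fib Q W)"
      using doctrine.reidx_closed[OF doctrine_Q] p by simp
    show "?E a \<sqsubseteq>\<^bsub>fib Q C\<^esub> b \<longleftrightarrow> a \<sqsubseteq>\<^bsub>fib Q W\<^esub> reidx Q p b"
      if "a \<in> carrier (fib Q W)" "b \<in> carrier (fib Q C)" for a b
      using that Obj ex(1) reidx_in_fib[OF p] filter_le_exists_iff[OF cone]
      by (auto elim!: Q_carrierE simp: E reidx_cls[OF p] cls_le_iff)
  qed
  show "exists_along Q p (cls W \<alpha>) = cls C (exists_along P p \<alpha>)" if "\<alpha> \<in> carrier (fib P W)"
    using exists_along_eqI[OF adj] that E by (simp add: st cls_closed)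
qed

lemma existential_Q: "existential_doctrine Q"
proof (intro existential_doctrine.intro existential_doctrine_axioms.intro primary_Q,
    unfold Q_simps)
  show "\<exists>E. left_adjoint_along Q p E" if "product_cone (base P) C B W p q" for C B W p q
    using left_adjoint_along_Q(1)[OF that] by blast
next
  fix C B W p q C' W' p' q' f h a
  assume cones: "product_cone (base P) C B W p q" "product_cone (base P) C' B W' p' q'"
    and f: "f \<in> homset (base P) C C'" and h: "h \<in> homset (base P) W W'"
    and comm: "p' \<odot>\<^bsub>base P\<^esub> h = f \<odot>\<^bsub>base P\<^esub> p" "q' \<odot>\<^bsub>base P\<^esub> h = q"
    and "a \<in> carrier (fib Q W')"
  then obtain \<alpha> where \<alpha>: "\<alpha> \<in> carrier (fib P W')" "a = cls W' \<alpha>"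
    by (auto elim!: Q_carrierE)
  show "exists_along Q p (reidx Q h a) = reidx Q f (exists_along Q p' a)"
    using Beck_Chevalley[OF cones f h comm \<alpha>(1)] \<alpha> reidx_in_fib[OF h]
      exists_along_adjoint(1)[OF cones(2)]
    by (simp add: reidx_cls[OF h] reidx_cls[OF f] left_adjoint_along_Q(2)[OF cones(1)]
        left_adjoint_along_Q(2)[OF cones(2)])
next
  fix C B W p q a b
  assume cone: "product_cone (base P) C B W p q"
    and "a \<in> carrier (fib Q W)" "b \<in> carrier (fib Q C)"
  moreover have "p \<in> homset (base P) W C" "W \<in> Obj (base P)" "C \<in> Obj (base P)"
    using cone by (auto simp: product_cone_def)
  ultimately show "exists_along Q p (a \<sqinter>\<^bsub>fib Q W\<^esub> reidx Q p b)
      = exists_along Q p a \<sqinter>\<^bsub>fib Q C\<^esub> b"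
    by (auto elim!: Q_carrierE simp: reidx_cls meet_cls left_adjoint_along_Q(2)[OF cone]
        reidx_in_fib fib_meet_closed exists_along_adjoint(1)[OF cone] Frobenius[OF cone])
qed

end

section \<open>The global points functor\<close>

lemma set_star_arrow_eqI:
  assumes "f \<in> homset set_star A B" "g \<in> homset set_star A B"
    and eq: "\<And>x. x \<in> A \<Longrightarrow> set_fun f x = set_fun g x"
  shows "f = g"
proof -
  obtain f' where f: "f = (A, f', B)" "f' \<in> A \<rightarrow>\<^sub>E B"
    using assms(1) by (rule homset_set_starE)
  obtain g' where g: "g = (A, g', B)" "g' \<in> A \<rightarrow>\<^sub>E B"
    using assms(2) by (rule homset_set_starE)
  have "f' = g'"
    using f(2) g(2) by (rule PiE_ext) (use eq f(1) g(1) in simp)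
  then show ?thesis
    by (simp add: f g)
qed

text \<open>Non-emptiness makes the functor land in \<open>set_star\<close>. Injectivity is required
  one hom-set at a time, which suffices to decode points of a known object; \<open>\<iota>\<close>
  may identify points of different objects.\<close>

locale pointed_category = finite_product_category C
  for C :: "('o, 'm) cat" +
  fixes t :: 'o and \<iota> :: "'m \<Rightarrow> 'u::infinite"
  assumes terminal: "terminal_object C t"
    and inj: "X \<in> Obj C \<Longrightarrow> inj_on \<iota> (homset C t X)"
    and points_nonempty: "X \<in> Obj C \<Longrightarrow> homset C t X \<noteq> {}"
begin

abbreviation \<Gamma> where "\<Gamma> \<equiv> global_points \<iota> C t"
abbreviation pts where "pts X \<equiv> \<iota> ` homset C t X"

lemma homset_ObjD:
  assumes "f \<in> homset C X Y"
  shows "X \<in> Obj C" "Y \<in> Obj C"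
  using assms Src_Obj Tgt_Obj unfolding homset_def by auto

lemma omap_points [simp]: "omap \<Gamma> X = pts X"
  by (simp add: global_points_def)

text \<open>Under the encoding the functor is postcomposition: \<open>inv_into\<close> recovers the
  arrow because \<open>\<iota>\<close> is injective on the points of \<open>X\<close>. The second
  part hides this decoding from later arguments.\<close>

lemma amap_points:
  assumes f: "f \<in> homset C X Y"
  shows "amap \<Gamma> f \<in> homset set_star (pts X) (pts Y)"
    and "c \<in> homset C t X \<Longrightarrow> set_fun (amap \<Gamma> f) (\<iota> c) = \<iota> (f \<odot>\<^bsub>C\<^esub> c)"
proof -
  let ?f = "\<lambda>u\<in>pts X. \<iota> (f \<odot>\<^bsub>C\<^esub> inv_into (homset C t X) \<iota> u)"
  have eq: "amap \<Gamma> f = (pts X, ?f, pts Y)"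
    using f by (simp add: global_points_def homset_def)
  have val: "?f (\<iota> c) = \<iota> (f \<odot>\<^bsub>C\<^esub> c)" if "c \<in> homset C t X" for c
    using that inj[OF homset_ObjD(1)[OF f]] by (simp add: inv_into_f_f)
  have "?f \<in> pts X \<rightarrow>\<^sub>E pts Y"
  proof (rule PiE_I)
    fix u assume "u \<in> pts X"
    then obtain c where c: "c \<in> homset C t X" "u = \<iota> c" by blast
    then show "?f u \<in> pts Y"
      using val Cmp_homset[OF c(1) f] by simp
  qed simp
  then show "amap \<Gamma> f \<in> homset set_star (pts X) (pts Y)"
    unfolding eq using points_nonempty homset_ObjD[OF f] by (intro homset_set_starI) auto
  show "c \<in> homset C t X \<Longrightarrow> set_fun (amap \<Gamma> f) (\<iota> c) = \<iota> (f \<odot>\<^bsub>C\<^esub> c)"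
    using val by (simp add: eq)
qed

lemma set_fun_Cmp:
  assumes "f \<in> homset set_star A B" "g \<in> homset set_star B D" "x \<in> A"
  shows "set_fun (g \<odot>\<^bsub>set_star\<^esub> f) x = set_fun g (set_fun f x)"
  using assms by (auto elim!: homset_set_starE simp: compose_def)

text \<open>Representable functors preserve products: the pointwise criterion for cones in
  \<open>set_star\<close> is the universal property of the given cone tested on arrows from
  \<open>t\<close>, read through \<open>\<iota>\<close>.\<close>

lemma points_product:
  assumes "product_cone C X Y W p q"
  shows "product_cone set_star (pts X) (pts Y) (pts W) (amap \<Gamma> p) (amap \<Gamma> q)"
proof -
  have p: "p \<in> homset C W X" and q: "q \<in> homset C W Y"
    and univ: "\<And>Z f g. \<lbrakk>Z \<in> Obj C; f \<in> homset C Z X; g \<in> homset C Z Y\<rbrakk>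
      \<Longrightarrow> \<exists>!h. h \<in> homset C Z W \<and> p \<odot>\<^bsub>C\<^esub> h = f \<and> q \<odot>\<^bsub>C\<^esub> h = g"
    using assms unfolding product_cone_def by auto
  have t: "t \<in> Obj C"
    using terminal unfolding terminal_object_def by blast
  show ?thesis
    unfolding product_cone_set_star_iff
  proof (intro conjI ballI amap_points(1)[OF p] amap_points(1)[OF q])
    fix a b assume "a \<in> pts X" "b \<in> pts Y"
    then obtain c d where c: "c \<in> homset C t X" "a = \<iota> c" and d: "d \<in> homset C t Y" "b = \<iota> d"
      by blast
    obtain h where h: "h \<in> homset C t W" "p \<odot>\<^bsub>C\<^esub> h = c" "q \<odot>\<^bsub>C\<^esub> h = d"
      and unique: "\<And>k. \<lbrakk>k \<in> homset C t W; p \<odot>\<^bsub>C\<^esub> k = c; q \<odot>\<^bsub>C\<^esub> k = d\<rbrakk> \<Longrightarrow> k = h"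
      using univ[OF t c(1) d(1)] by (elim ex1E) blast
    show "\<exists>!w. w \<in> pts W \<and> set_fun (amap \<Gamma> p) w = a \<and> set_fun (amap \<Gamma> q) w = b"
    proof (rule ex1I[of _ "\<iota> h"])
      show "\<iota> h \<in> pts W \<and> set_fun (amap \<Gamma> p) (\<iota> h) = a \<and> set_fun (amap \<Gamma> q) (\<iota> h) = b"
        using h c(2) d(2) by (simp add: amap_points(2)[OF p] amap_points(2)[OF q])
    next
      fix w assume w: "w \<in> pts W \<and> set_fun (amap \<Gamma> p) w = a \<and> set_fun (amap \<Gamma> q) w = b"
      then obtain k where k: "k \<in> homset C t W" "w = \<iota> k" by blast
      then have "\<iota> (p \<odot>\<^bsub>C\<^esub> k) = \<iota> c" "\<iota> (q \<odot>\<^bsub>C\<^esub> k) = \<iota> d"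
        using w c(2) d(2) amap_points(2)[OF p k(1)] amap_points(2)[OF q k(1)] by simp_all
      then have "p \<odot>\<^bsub>C\<^esub> k = c" "q \<odot>\<^bsub>C\<^esub> k = d"
        using inj_onD[OF inj[OF homset_ObjD(2)[OF p]] _ Cmp_homset[OF k(1) p] c(1)]
          inj_onD[OF inj[OF homset_ObjD(2)[OF q]] _ Cmp_homset[OF k(1) q] d(1)] by simp_all
      with k show "w = \<iota> h"
        using unique by simp
    qed
  qed
qed

lemma finite_product_functor_points: "finite_product_functor C set_star \<Gamma>"
proof (intro finite_product_functor.intro finite_product_functor_axioms.intro
    finite_product_category_axioms finite_product_category_set_star)
  show "omap \<Gamma> X \<in> Obj set_star" if "X \<in> Obj C" for X
    using points_nonempty[OF that] by simp
  show "amap \<Gamma> f \<in> homset set_star (omap \<Gamma> X) (omap \<Gamma> Y)" if "f \<in> homset C X Y" for f X Y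
    using amap_points(1)[OF that] by simp
  show "amap \<Gamma> (Idt C X) = Idt set_star (omap \<Gamma> X)" if X: "X \<in> Obj C" for X
  proof (rule set_star_arrow_eqI)
    show "amap \<Gamma> (Idt C X) \<in> homset set_star (pts X) (pts X)"
      using Idt_homset[OF X] by (rule amap_points)
    show "Idt set_star (omap \<Gamma> X) \<in> homset set_star (pts X) (pts X)"
      using category.Idt_homset[OF category_set_star, of "pts X"] points_nonempty[OF X] by simp
    show "set_fun (amap \<Gamma> (Idt C X)) x = set_fun (Idt set_star (omap \<Gamma> X)) x" if "x \<in> pts X" for x
      using that amap_points(2)[OF Idt_homset[OF X]] Cmp_Idt_left by auto
  qed
  show "amap \<Gamma> (g \<odot>\<^bsub>C\<^esub> f) = amap \<Gamma> g \<odot>\<^bsub>set_star\<^esub> amap \<Gamma> f"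
    if f: "f \<in> homset C X Y" and g: "g \<in> homset C Y Z" for f g X Y Z
  proof (rule set_star_arrow_eqI)
    show "amap \<Gamma> (g \<odot>\<^bsub>C\<^esub> f) \<in> homset set_star (pts X) (pts Z)"
      using Cmp_homset[OF f g] by (rule amap_points)
    show "amap \<Gamma> g \<odot>\<^bsub>set_star\<^esub> amap \<Gamma> f \<in> homset set_star (pts X) (pts Z)"
      by (rule category.Cmp_homset[OF category_set_star amap_points(1)[OF f] amap_points(1)[OF g]])
    fix x assume "x \<in> pts X"
    then obtain c where c: "c \<in> homset C t X" "x = \<iota> c" by blast
    then show "set_fun (amap \<Gamma> (g \<odot>\<^bsub>C\<^esub> f)) x = set_fun (amap \<Gamma> g \<odot>\<^bsub>set_star\<^esub> amap \<Gamma> f) x"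
      using Cmp_homset[OF c(1) f] Cmp_assoc[OF c(1) f g]
      by (simp add: set_fun_Cmp[OF amap_points(1)[OF f] amap_points(1)[OF g]]
          amap_points(2)[OF f] amap_points(2)[OF g] amap_points(2)[OF Cmp_homset[OF f g]])
  qed
  show "terminal_object set_star (omap \<Gamma> s)" if "terminal_object C s" for s
  proof -
    have "t \<in> Obj C"
      using terminal unfolding terminal_object_def by blast
    \<comment> \<open>Preservation is demanded for every terminal object \<open>s\<close>, not just
      \<open>t\<close>. There is exactly one arrow from \<open>t\<close> to \<open>s\<close>, so its
      encoding is a singleton, and singletons are terminal.\<close>
    then have "\<exists>!f. f \<in> homset C t s"
      using that unfolding terminal_object_def by blast
    then obtain c where "homset C t s = {c}"
      by auto
    then show ?thesis
      using terminal_set_star by simp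
  qed
  show "product_cone set_star (omap \<Gamma> X) (omap \<Gamma> Y) (omap \<Gamma> W) (amap \<Gamma> p) (amap \<Gamma> q)"
    if "product_cone C X Y W p q" for X Y W p q
    using points_product[OF that] by simp
qed

end

section \<open>The truth morphism\<close>

locale ultrafiltered_rich_doctrine =
  filtered_existential_doctrine P t N + bounded: bounded_doctrine P +
  implicational_doctrine P + rich_doctrine P t
  for P :: "('o, 'm, 'p) doctrine" and t :: 'o and N :: "'p set" +
  fixes \<iota> :: "'m \<Rightarrow> 'u::infinite"
  assumes ultrafilter: "a \<in> carrier (fib P t) \<Longrightarrow> (a \<in> N) \<noteq> (heyting_neg (fib P t) a \<in> N)"
    and inj_points: "X \<in> Obj (base P) \<Longrightarrow> inj_on \<iota> (homset (base P) t X)"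
begin

sublocale base: finite_product_category "base P"
  by (rule base_category)

text \<open>Richness applied to \<open>\<top>\<close> produces an arrow from \<open>t\<close> to any
  object; of that statement only the existence of the arrow is kept.\<close>

sublocale points: pointed_category "base P" t \<iota>
proof
  fix X assume X: "X \<in> Obj (base P)"
  show "homset (base P) t X \<noteq> {}"
    using rich[OF X fib_top_closed[OF X]] by blast
qed (fact terminal inj_points)+

text \<open>Truth of an implication is the classical conditional. Left to right is modus ponens
  inside the filter. For the converse, a true \<open>b\<close> lies below the implication; if
  instead \<open>a\<close> fails, the ultrafilter contains its negation, which lies below the
  implication because \<open>\<bottom>\<close> entails \<open>b\<close>.\<close>

lemma filter_imp_iff:
  assumes a: "a \<in> carrier (fib P t)" and b: "b \<in> carrier (fib P t)"
  shows "heyting_imp (fib P t) a b \<in> N \<longleftrightarrow> (a \<in> N \<longrightarrow> b \<in> N)"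
proof
  note imp = heyting_imp_closed[OF t_Obj a b]
  note imp_iff = le_heyting_imp_iff[OF t_Obj a b]
  show "a \<in> N \<longrightarrow> b \<in> N" if "heyting_imp (fib P t) a b \<in> N"
  proof
    assume "a \<in> N"
    with that have "heyting_imp (fib P t) a b \<sqinter>\<^bsub>fib P t\<^esub> a \<in> N"
      by (rule filter_meet)
    then show "b \<in> N"
      using b imp_iff[OF imp] fib_le_refl[OF t_Obj imp] by (auto intro: filter_up)
  qed
  show "heyting_imp (fib P t) a b \<in> N" if "a \<in> N \<longrightarrow> b \<in> N"
  proof (cases "a \<in> N")
    case True
    moreover have "b \<sqsubseteq>\<^bsub>fib P t\<^esub> heyting_imp (fib P t) a b"
      using imp_iff[OF b] fib_meet_left[OF t_Obj b a] by simp
    ultimately show ?thesis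
      using that imp filter_up by blast
  next
    case False
    interpret weak_partial_order_bottom "fib P t"
      using t_Obj by (rule bounded.fib_bottom)
    let ?n = "heyting_neg (fib P t) a"
    have n: "?n \<in> carrier (fib P t)" "?n \<sqinter>\<^bsub>fib P t\<^esub> a \<sqsubseteq>\<^bsub>fib P t\<^esub> \<bottom>\<^bsub>fib P t\<^esub>"
      unfolding heyting_neg_def
      using le_heyting_imp_iff[OF t_Obj a bottom_closed] heyting_imp_closed[OF t_Obj a bottom_closed]
        fib_le_refl[OF t_Obj] by blast+
    have "?n \<sqinter>\<^bsub>fib P t\<^esub> a \<sqsubseteq>\<^bsub>fib P t\<^esub> b"
      by (rule fib_le_trans[OF t_Obj n(2) bottom_lower[OF b] fib_meet_closed[OF t_Obj n(1) a]
          bottom_closed b])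
    then have "?n \<sqsubseteq>\<^bsub>fib P t\<^esub> heyting_imp (fib P t) a b"
      using imp_iff[OF n(1)] by simp
    moreover have "?n \<in> N"
      using ultrafilter[OF a] False by blast
    ultimately show ?thesis
      using imp filter_up by blast
  qed
qed

text \<open>Since \<open>\<top>\<close> is in the ultrafilter, its negation is not; a member
  \<open>\<bottom>\<close> would make that negation true by the conditional reading of
  implication.\<close>

lemma bottom_notin_filter: "\<bottom>\<^bsub>fib P t\<^esub> \<notin> N"
proof -
  interpret weak_partial_order_bottom "fib P t"
    using t_Obj by (rule bounded.fib_bottom)
  have "heyting_neg (fib P t) \<top>\<^bsub>fib P t\<^esub> \<notin> N"
    using ultrafilter[OF fib_top_closed[OF t_Obj]] filter_top by blast
  then show ?thesis
    unfolding heyting_neg_def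
    using filter_imp_iff[OF fib_top_closed[OF t_Obj] bottom_closed] by blast
qed

lemma filter_meet_iff:
  assumes "a \<in> carrier (fib P t)" "b \<in> carrier (fib P t)"
  shows "a \<sqinter>\<^bsub>fib P t\<^esub> b \<in> N \<longleftrightarrow> a \<in> N \<and> b \<in> N"
  using filter_meet filter_up[OF _ assms(1) fib_meet_left[OF t_Obj assms]]
    filter_up[OF _ assms(2) fib_meet_right[OF t_Obj assms]] by blast

section \<open>Truth at a point\<close>

abbreviation \<gg> where "\<gg> \<equiv> truth_points \<iota> P t N"
abbreviation holds where "holds X \<phi> \<equiv> {c \<in> homset (base P) t X. reidx P c \<phi> \<in> N}"

text \<open>Equivalent formulas hold at the same points, because entailment modulo the filter
  survives reindexing along \<open>c\<close> and then preserves membership in \<open>N\<close>. So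
  the union over representatives collapses to the contribution of \<open>\<phi>\<close>.\<close>

lemma truth_cls:
  assumes X: "X \<in> Obj (base P)" and \<phi>: "\<phi> \<in> carrier (fib P X)"
  shows "\<gg> X (cls X \<phi>) = \<iota> ` holds X \<phi>"
proof -
  have "holds X \<psi> \<subseteq> holds X \<phi>" if "\<psi> \<in> cls X \<phi>" for \<psi>
  proof safe
    fix c assume c: "c \<in> homset (base P) t X" "reidx P c \<psi> \<in> N"
    have "\<psi> \<in> carrier (fib P X)" "fle X \<psi> \<phi>"
      using that by (auto simp: mem_cls_iff)
    then show "reidx P c \<phi> \<in> N"
      using filter_le_t_mem[OF c(2) reidx_in_fib[OF c(1) \<phi>]] filter_le_reidx[OF c(1) _ \<phi>] by blast
  qed
  then show ?thesis
    unfolding truth_points_def using cls_self[OF X \<phi>] by blast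
qed

lemma holds_reidx:
  assumes "f \<in> homset (base P) X Y" "\<phi> \<in> carrier (fib P Y)" "c \<in> homset (base P) t X"
  shows "c \<in> holds X (reidx P f \<phi>) \<longleftrightarrow> f \<odot>\<^bsub>base P\<^esub> c \<in> holds Y \<phi>"
  using assms base.Cmp_homset[OF assms(3,1)] reidx_Cmp[OF assms(3,1,2)] by simp

text \<open>\<open>B\<close> is its own product with \<open>t\<close>. Richness quantifies along
  \<open>bang\<close>, the first leg of this cone, so the cone is what allows Beck--Chevalley to
  produce the quantifier that richness speaks about.\<close>

lemma terminal_product_cone:
  assumes B: "B \<in> Obj (base P)"
  shows "product_cone (base P) t B B (bang (base P) t B) (Idt (base P) B)"
  unfolding product_cone_def
proof (intro conjI ballI t_Obj B bang_homset base.Idt_homset)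
  fix Z f g
  assume f: "f \<in> homset (base P) Z t" and g: "g \<in> homset (base P) Z B"
  show "\<exists>!h. h \<in> homset (base P) Z B \<and> bang (base P) t B \<odot>\<^bsub>base P\<^esub> h = f
      \<and> Idt (base P) B \<odot>\<^bsub>base P\<^esub> h = g"
  proof (rule ex1I[of _ g])
    show "g \<in> homset (base P) Z B \<and> bang (base P) t B \<odot>\<^bsub>base P\<^esub> g = f
        \<and> Idt (base P) B \<odot>\<^bsub>base P\<^esub> g = g"
      using g base.Cmp_Idt_left[OF g] eq_bang[OF f]
        eq_bang[OF base.Cmp_homset[OF g bang_homset[OF B]]] by simp
  next
    fix h assume "h \<in> homset (base P) Z B \<and> bang (base P) t B \<odot>\<^bsub>base P\<^esub> h = f
        \<and> Idt (base P) B \<odot>\<^bsub>base P\<^esub> h = g"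
    then show "h = g"
      using base.Cmp_Idt_left by auto
  qed
qed

text \<open>Beck--Chevalley moves the quantifier along \<open>c\<close> to one over the terminal object, where
  richness supplies a witness \<open>d\<close>; pairing \<open>c\<close> with \<open>d\<close> gives the point of the product.\<close>

lemma holds_exists_witness:
  assumes cone: "product_cone (base P) C B W p q" and \<alpha>: "\<alpha> \<in> carrier (fib P W)"
    and c: "c \<in> holds C (exists_along P p \<alpha>)"
  shows "\<exists>w \<in> holds W \<alpha>. p \<odot>\<^bsub>base P\<^esub> w = c"
proof -
  have B: "B \<in> Obj (base P)" and p: "p \<in> homset (base P) W C"
    and univ: "\<And>Z f g. \<lbrakk>Z \<in> Obj (base P); f \<in> homset (base P) Z C; g \<in> homset (base P) Z B\<rbrakk>
      \<Longrightarrow> \<exists>!h. h \<in> homset (base P) Z W \<and> p \<odot>\<^bsub>base P\<^esub> h = f \<and> q \<odot>\<^bsub>base P\<^esub> h = g"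
    using cone unfolding product_cone_def by auto
  let ?b = "bang (base P) t B"
  note b = bang_homset[OF B]
  have c_hom: "c \<in> homset (base P) t C"
    using c by simp
  \<comment> \<open>With \<open>B\<close> in the role of the product of \<open>t\<close> and
    \<open>B\<close>, this is the arrow written \<open>c \<times> id\<close>; its two equations are
    those required by \<open>Beck_Chevalley\<close>.\<close>
  obtain h where h: "h \<in> homset (base P) B W" "p \<odot>\<^bsub>base P\<^esub> h = c \<odot>\<^bsub>base P\<^esub> ?b"
      "q \<odot>\<^bsub>base P\<^esub> h = Idt (base P) B"
    using univ[OF B base.Cmp_homset[OF b c_hom] base.Idt_homset[OF B]] by (elim ex1E) blast
  note h\<alpha> = reidx_in_fib[OF h(1) \<alpha>]
  have "exists_along P ?b (reidx P h \<alpha>) = reidx P c (exists_along P p \<alpha>)"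
    by (rule Beck_Chevalley[OF terminal_product_cone[OF B] cone c_hom h \<alpha>])
  moreover obtain d where d: "d \<in> homset (base P) t B"
      "exists_along P ?b (reidx P h \<alpha>) \<sqsubseteq>\<^bsub>fib P t\<^esub> reidx P d (reidx P h \<alpha>)"
    using rich[OF B h\<alpha>] by blast
  ultimately have "reidx P d (reidx P h \<alpha>) \<in> N"
    using c filter_up[OF _ reidx_in_fib[OF d(1) h\<alpha>]] by auto
  then have "h \<odot>\<^bsub>base P\<^esub> d \<in> holds W \<alpha>"
    using holds_reidx[OF h(1) \<alpha> d(1)] d(1) by simp
  moreover have "?b \<odot>\<^bsub>base P\<^esub> d = Idt (base P) t"
    using eq_bang[OF base.Cmp_homset[OF d(1) b]] eq_bang[OF base.Idt_homset[OF t_Obj]] by simp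
  then have "p \<odot>\<^bsub>base P\<^esub> (h \<odot>\<^bsub>base P\<^esub> d) = c"
    using base.Cmp_assoc[OF d(1) h(1) p] base.Cmp_assoc[OF d(1) b c_hom] h(2)
      base.Cmp_Idt_right[OF c_hom] by simp
  ultimately show ?thesis
    by blast
qed

text \<open>One inclusion is the witness supplied by richness. The other reindexes the unit of the
  adjunction along \<open>w\<close> and uses upward closure of the filter.\<close>

lemma holds_exists:
  assumes cone: "product_cone (base P) C B W p q" and \<alpha>: "\<alpha> \<in> carrier (fib P W)"
  shows "holds C (exists_along P p \<alpha>) = (\<lambda>w. p \<odot>\<^bsub>base P\<^esub> w) ` holds W \<alpha>"
proof (intro equalityI subsetI)
  fix c assume "c \<in> holds C (exists_along P p \<alpha>)"
  then show "c \<in> (\<lambda>w. p \<odot>\<^bsub>base P\<^esub> w) ` holds W \<alpha>"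
    using holds_exists_witness[OF cone \<alpha>] by blast
next
  have p: "p \<in> homset (base P) W C" and Obj: "C \<in> Obj (base P)"
    using cone unfolding product_cone_def by auto
  note ex = exists_along_adjoint(1)[OF cone \<alpha>]
  fix c assume "c \<in> (\<lambda>w. p \<odot>\<^bsub>base P\<^esub> w) ` holds W \<alpha>"
  then obtain w where w: "w \<in> homset (base P) t W" "reidx P w \<alpha> \<in> N" "c = p \<odot>\<^bsub>base P\<^esub> w"
    by blast
  have "\<alpha> \<sqsubseteq>\<^bsub>fib P W\<^esub> reidx P p (exists_along P p \<alpha>)"
    using exists_along_adjoint(2)[OF cone \<alpha> ex] fib_le_refl[OF Obj ex] by simp
  then have "reidx P w (reidx P p (exists_along P p \<alpha>)) \<in> N"
    using reidx_le[OF w(1) \<alpha> reidx_in_fib[OF p ex]]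
      filter_up[OF w(2) reidx_in_fib[OF w(1) reidx_in_fib[OF p ex]]] by blast
  then show "c \<in> holds C (exists_along P p \<alpha>)"
    using holds_reidx[OF p ex w(1)] w by simp
qed

section \<open>Naturality and preservation of the logical structure\<close>

lemma truth_morphism: "doctrine_morphism Q subsets_star points.\<Gamma> \<gg>"
proof (intro doctrine_morphism.intro doctrine_morphism_axioms.intro doctrine_Q doctrine_subsets_star,
    unfold Q_simps subsets_star_simps points.omap_points)
  show "finite_product_functor (base P) set_star points.\<Gamma>"
    by (rule points.finite_product_functor_points)
next
  fix X assume X: "X \<in> Obj (base P)"
  show "\<gg> X \<in> carrier (fib Q X) \<rightarrow> Pow (points.pts X)"
    using truth_cls[OF X] by (auto elim!: Q_carrierE)
  show "isotone (fib Q X) (fib subsets_star (points.pts X)) (\<gg> X)"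
  proof (rule isotoneI)
    fix a b assume "a \<in> carrier (fib Q X)" "b \<in> carrier (fib Q X)" and le: "a \<sqsubseteq>\<^bsub>fib Q X\<^esub> b"
    then obtain \<alpha> \<beta> where \<alpha>\<beta>: "\<alpha> \<in> carrier (fib P X)" "\<beta> \<in> carrier (fib P X)"
        "a = cls X \<alpha>" "b = cls X \<beta>"
      by (auto elim!: Q_carrierE)
    have "fle X \<alpha> \<beta>"
      using le \<alpha>\<beta> cls_le_iff[OF X] by simp
    then have "holds X \<alpha> \<subseteq> holds X \<beta>"
      using filter_le_reidx[OF _ \<alpha>\<beta>(1,2)] filter_le_t_mem reidx_in_fib[OF _ \<alpha>\<beta>(2)] by blast
    then show "\<gg> X a \<sqsubseteq>\<^bsub>fib subsets_star (points.pts X)\<^esub> \<gg> X b"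
      using \<alpha>\<beta> truth_cls[OF X] by auto
  qed (use partial_order_Q[OF X] partial_order_subsets_star in
      \<open>blast intro: partial_order.axioms(1)\<close>)+
next
  fix f X Y b assume f: "f \<in> homset (base P) X Y" and "b \<in> carrier (fib Q Y)"
  then obtain \<beta> where \<beta>: "\<beta> \<in> carrier (fib P Y)" "b = cls Y \<beta>"
    by (auto elim!: Q_carrierE)
  note Obj = homset_Obj[OF f]
  obtain k where k: "amap points.\<Gamma> f = (points.pts X, k, points.pts Y)"
    using points.amap_points(1)[OF f] by (rule homset_set_starE)
  \<comment> \<open>Membership of an encoded point in an encoded truth set reduces to membership of
    the point itself, by injectivity over \<open>X\<close> and over \<open>Y\<close> separately;
    naturality then becomes functoriality of reindexing.\<close>
  have "\<iota> c \<in> \<iota> ` holds X (reidx P f \<beta>) \<longleftrightarrow> k (\<iota> c) \<in> \<iota> ` holds Y \<beta>"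
    if c: "c \<in> homset (base P) t X" for c
  proof -
    have "k (\<iota> c) = \<iota> (f \<odot>\<^bsub>base P\<^esub> c)"
      using points.amap_points(2)[OF f c] k by simp
    moreover have "\<iota> (f \<odot>\<^bsub>base P\<^esub> c) \<in> \<iota> ` holds Y \<beta> \<longleftrightarrow> f \<odot>\<^bsub>base P\<^esub> c \<in> holds Y \<beta>"
      by (rule inj_on_image_mem_iff[OF inj_points[OF Obj(2)] base.Cmp_homset[OF c f]]) blast
    moreover have "\<iota> c \<in> \<iota> ` holds X (reidx P f \<beta>) \<longleftrightarrow> c \<in> holds X (reidx P f \<beta>)"
      by (rule inj_on_image_mem_iff[OF inj_points[OF Obj(1)] c]) blast
    ultimately show ?thesis
      using holds_reidx[OF f \<beta>(1) c] by simp
  qed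
  then have "\<iota> ` holds X (reidx P f \<beta>) = {u \<in> points.pts X. k u \<in> \<iota> ` holds Y \<beta>}"
    by blast
  then show "\<gg> X (reidx Q f b) = reidx subsets_star (amap points.\<Gamma> f) (\<gg> Y b)"
    using truth_cls[OF Obj(1) reidx_in_fib[OF f \<beta>(1)]] truth_cls[OF Obj(2) \<beta>(1)]
    by (simp add: \<beta>(2) reidx_cls[OF f \<beta>(1)] k)
qed

lemma truth_top: "X \<in> Obj (base P) \<Longrightarrow> \<gg> X \<top>\<^bsub>fib Q X\<^esub> = points.pts X"
  using filter_top reidx_top by (auto simp: top_Q truth_cls fib_top_closed)

lemma bounded_truth_morphism: "bounded_morphism Q subsets_star points.\<Gamma> \<gg>"
proof (intro bounded_morphism.intro bounded_morphism_axioms.intro truth_morphism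
    bounded_Q bounded_subsets_star bounded.bounded_doctrine_axioms,
    unfold Q_simps subsets_star_simps points.omap_points top_subsets_star bottom_subsets_star)
  fix X assume X: "X \<in> Obj (base P)"
  show "\<gg> X \<top>\<^bsub>fib Q X\<^esub> = points.pts X"
    using X by (rule truth_top)
  have "\<bottom>\<^bsub>fib P X\<^esub> \<in> carrier (fib P X)"
    using bounded.fib_bottom[OF X] by (rule weak_partial_order_bottom.bottom_closed)
  \<comment> \<open>Reindexing along any point turns \<open>\<bottom>\<close> into the bottom over
    \<open>t\<close>, which is outside the filter.\<close>
  then show "\<gg> X \<bottom>\<^bsub>fib Q X\<^esub> = {}"
    using bottom_notin_filter bounded.reidx_bottom X
    by (auto simp: bottom_Q(2)[OF bounded.bounded_doctrine_axioms X] truth_cls)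
qed

lemma primary_truth_morphism: "primary_morphism Q subsets_star points.\<Gamma> \<gg>"
proof (intro primary_morphism.intro primary_morphism_axioms.intro truth_morphism primary_Q
    implicational_doctrine.axioms(1)[OF implicational_subsets_star],
    unfold Q_simps subsets_star_simps points.omap_points top_subsets_star)
  fix X assume X: "X \<in> Obj (base P)"
  show "\<gg> X \<top>\<^bsub>fib Q X\<^esub> = points.pts X"
    using X by (rule truth_top)
  fix a b assume "a \<in> carrier (fib Q X)" "b \<in> carrier (fib Q X)"
  then obtain \<alpha> \<beta> where \<alpha>\<beta>: "\<alpha> \<in> carrier (fib P X)" "\<beta> \<in> carrier (fib P X)"
      "a = cls X \<alpha>" "b = cls X \<beta>"
    by (auto elim!: Q_carrierE)
  have "holds X (\<alpha> \<sqinter>\<^bsub>fib P X\<^esub> \<beta>) = holds X \<alpha> \<inter> holds X \<beta>"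
    using \<alpha>\<beta> by (auto simp: reidx_meet filter_meet_iff reidx_in_fib)
  \<comment> \<open>Direct images preserve intersections only up to inclusion in general;
    injectivity on the points of \<open>X\<close> gives equality.\<close>
  moreover have "\<iota> ` (holds X \<alpha> \<inter> holds X \<beta>) = \<iota> ` holds X \<alpha> \<inter> \<iota> ` holds X \<beta>"
    by (rule inj_on_image_Int[OF inj_points[OF X]]) auto
  moreover have "\<iota> ` holds X \<alpha> \<subseteq> points.pts X" "\<iota> ` holds X \<beta> \<subseteq> points.pts X"
    by auto
  ultimately show "\<gg> X (a \<sqinter>\<^bsub>fib Q X\<^esub> b) = \<gg> X a \<sqinter>\<^bsub>fib subsets_star (points.pts X)\<^esub> \<gg> X b"
    using X \<alpha>\<beta> by (simp add: meet_cls truth_cls fib_meet_closed)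
qed

lemma implicational_truth_morphism: "implicational_morphism Q subsets_star points.\<Gamma> \<gg>"
proof (intro implicational_morphism.intro implicational_morphism_axioms.intro
    primary_truth_morphism implicational_Q implicational_subsets_star
    implicational_doctrine_axioms, unfold Q_simps points.omap_points)
  fix X a b assume X: "X \<in> Obj (base P)" and "a \<in> carrier (fib Q X)" "b \<in> carrier (fib Q X)"
  then obtain \<alpha> \<beta> where \<alpha>\<beta>: "\<alpha> \<in> carrier (fib P X)" "\<beta> \<in> carrier (fib P X)"
      "a = cls X \<alpha>" "b = cls X \<beta>"
    by (auto elim!: Q_carrierE)
  have "holds X (heyting_imp (fib P X) \<alpha> \<beta>)
      = {c \<in> homset (base P) t X. c \<in> holds X \<alpha> \<longrightarrow> c \<in> holds X \<beta>}"
    using \<alpha>\<beta> by (auto simp: reidx_imp filter_imp_iff reidx_in_fib)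
  \<comment> \<open>Injectivity is essential on the premise side: an encoded point in the image of
    the truth set of \<open>\<alpha>\<close> must come from a point where \<open>\<alpha>\<close>
    really holds.\<close>
  then have "\<iota> ` holds X (heyting_imp (fib P X) \<alpha> \<beta>)
      = {u \<in> points.pts X. u \<in> \<iota> ` holds X \<alpha> \<longrightarrow> u \<in> \<iota> ` holds X \<beta>}"
    using inj_points[OF X] by (auto dest: inj_onD)
  moreover have "\<iota> ` holds X \<alpha> \<subseteq> points.pts X" "\<iota> ` holds X \<beta> \<subseteq> points.pts X"
    by auto
  ultimately show "\<gg> X (heyting_imp (fib Q X) a b)
      = heyting_imp (fib subsets_star (points.pts X)) (\<gg> X a) (\<gg> X b)"
    using heyting_imp_cls[OF implicational_doctrine_axioms X \<alpha>\<beta>(1,2)]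
      heyting_imp_closed[OF X \<alpha>\<beta>(1,2)]
    by (simp add: \<alpha>\<beta> X truth_cls heyting_imp_subsets_star)
qed

lemma existential_truth_morphism: "existential_morphism Q subsets_star points.\<Gamma> \<gg>"
proof (intro existential_morphism.intro existential_morphism_axioms.intro
    primary_truth_morphism existential_Q existential_subsets_star, unfold Q_simps)
  fix C B W p q a
  assume cone: "product_cone (base P) C B W p q" and "a \<in> carrier (fib Q W)"
  then obtain \<alpha> where \<alpha>: "\<alpha> \<in> carrier (fib P W)" "a = cls W \<alpha>"
    by (auto elim!: Q_carrierE)
  have p: "p \<in> homset (base P) W C"
    using cone unfolding product_cone_def by blast
  note Obj = homset_Obj[OF p]
  have "exists_along subsets_star (amap points.\<Gamma> p) (\<iota> ` holds W \<alpha>)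
      = set_fun (amap points.\<Gamma> p) ` \<iota> ` holds W \<alpha>"
    by (rule exists_along_subsets_star[OF points.amap_points(1)[OF p]]) blast
  \<comment> \<open>The quantifier of the subsets doctrine is direct image, and on encoded points it
    amounts to postcomposition with \<open>p\<close>; this is the form in which
    \<open>holds_exists\<close> applies.\<close>
  also have "\<dots> = \<iota> ` (\<lambda>w. p \<odot>\<^bsub>base P\<^esub> w) ` holds W \<alpha>"
    unfolding image_image by (rule image_cong) (auto simp: points.amap_points(2)[OF p])
  also have "\<dots> = \<iota> ` holds C (exists_along P p \<alpha>)"
    by (simp only: holds_exists[OF cone \<alpha>(1)])
  finally show "\<gg> C (exists_along Q p a) = exists_along subsets_star (amap points.\<Gamma> p) (\<gg> W a)"
    using truth_cls[OF Obj(1) \<alpha>(1)] truth_cls[OF Obj(2) exists_along_adjoint(1)[OF cone \<alpha>(1)]]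
      left_adjoint_along_Q(2)[OF cone \<alpha>(1)] by (simp add: \<alpha>(2))
qed

end

theorem proposition4p11:
  fixes P :: "('o, 'm, 'p) doctrine" and t :: 'o and N :: "'p set"
    and \<iota> :: "'m \<Rightarrow> 'u::infinite"
  assumes "terminal_object (base P) t"
    and "bounded_doctrine P"
    and "consistent_doctrine P t"
    and "implicational_doctrine P"
    and "existential_doctrine P"
    and "rich_doctrine P t"
    and "semilattice_ultrafilter (fib P t) N"
    and "\<And>X. X \<in> Obj (base P) \<Longrightarrow> inj_on \<iota> (homset (base P) t X)"
  defines "Q \<equiv> quotient_doctrine P t N"
    and "\<Gamma> \<equiv> global_points \<iota> (base P) t"
    and "\<gg> \<equiv> truth_points \<iota> P t N"
  shows "(\<forall>X\<in>Obj (base P). \<forall>\<phi>\<in>carrier (fib P X).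
            \<gg> X (filter_class P t N X \<phi>) = \<iota> ` {c \<in> homset (base P) t X. reidx P c \<phi> \<in> N})
       \<and> bounded_morphism Q subsets_star \<Gamma> \<gg>
       \<and> implicational_morphism Q subsets_star \<Gamma> \<gg>
       \<and> existential_morphism Q subsets_star \<Gamma> \<gg>"
proof -
  interpret P: existential_doctrine P by fact
  have "filtered_doctrine P t N"
    using assms(1,7) by unfold_locales (auto simp: semilattice_ultrafilter_def)
  then interpret ultrafiltered_rich_doctrine P t N \<iota>
    using assms
    by (intro ultrafiltered_rich_doctrine.intro filtered_existential_doctrine.intro
        ultrafiltered_rich_doctrine_axioms.intro) (auto simp: semilattice_ultrafilter_def)
  show ?thesis
    unfolding Q_def \<Gamma>_def \<gg>_def
    using truth_cls bounded_truth_morphism implicational_truth_morphism existential_truth_morphism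
    by blast
qed

end
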